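(* Let ${\bf q}=(q_1,q_2)^T\in L_2(\mathbb{R}_+,\mathbb{C}^2)$ be non-cyclic for the backward shift operator $T^*$ on $L_2(\mathbb{R}_+,\mathbb{C}^2)$. Then there exist a closed subspace $\mathfrak{H}_0$ of $L_2(\mathbb{R}_+,\mathbb{C}^2)$ and a simple maximal symmetric operator $B$ acting in $\mathfrak{H}_0$ such that, for every $a\in\mathbb{C}$, the operator ${\bf H}_{a{\bf q}}$ is an extension of the symmetric operator $B^2$, i.e. $\mathcal{D}(B^2)\subset\mathcal{D}({\bf H}_{a{\bf q}})$ and ${\bf H}_{a{\bf q}}{\bf u}=B^2{\bf u}$ for all ${\bf u}\in\mathcal{D}(B^2)$.
   Context: $L_2(\mathbb{R}_+,\mathbb{C}^2)$ carries the inner product $({\bf f},{\bf g})_+=\int_0^\infty (f_1\overline{g_1}+f_2\overline{g_2})\,dx$ for ${\bf f}=(f_1,f_2)^T$, ${\bf g}=(g_1,g_2)^T$. For ${\bf f}\in W_2^2(\mathbb{R}_+,\mathbb{C}^2)$ put $[{\bf f}]_r=\frac12\lim_{x\to0+}(f_1(x)+f_2(x))$ and $[{\bf f}]_s=\lim_{x\to0+}(f_1(x)-f_2(x))$ (and $[{\bf f}']_r$ is the same with ${\bf f}'$ in place of ${\bf f}$). For ${\bf q}\in L_2(\mathbb{R}_+,\mathbb{C}^2)$ and $a\in\mathbb{C}$, ${\bf H}_{a{\bf q}}$ is the operator in $L_2(\mathbb{R}_+,\mathbb{C}^2)$ given by ${\bf H}_{a{\bf q}}{\bf f}=-{\bf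 f}''+[{\bf f}]_r{\bf q}$ with domain $\{{\bf f}\in W_2^2(\mathbb{R}_+,\mathbb{C}^2): [{\bf f}]_s=0,\ [{\bf f}']_r=a[{\bf f}]_r+({\bf f},{\bf q})_+\}$. Let $\mathcal{B}=i\,d/dx$ with domain $\{u\in W_2^1(\mathbb{R}_+): u(0)=0\}$ in $L_2(\mathbb{R}_+)$, and use the same symbol for the componentwise operator in $L_2(\mathbb{R}_+,\mathbb{C}^2)$; $T=(\mathcal{B}-iI)(\mathcal{B}+iI)^{-1}$ (the forward shift), $T^*$ its adjoint. ${\bf q}$ is non-cyclic for $T^*$ if the closed linear span of $\{T^{*n}{\bf q}: n\ge0\}$ is not all of $L_2(\mathbb{R}_+,\mathbb{C}^2)$. A symmetric operator is simple if its restriction to any nontrivial reducing subspace is not self-adjoint; it is maximal symmetric if it has no proper symmetric extension (equivalently, one of its defect numbers is zero). *)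

theory Defs
  imports "HOL-Analysis.Analysis"
begin

text \<open>Elements of L_2(R_+,C^2) are represented by functions real => complex x complex
  (only their values on (0,oo) matter); equality in L_2 is equality almost everywhere
  w.r.t. Lebesgue measure on (0,oo). Operators are represented by their graphs, which are
  required to be saturated under a.e. equality.\<close>

type_synonym vf = "real \<Rightarrow> complex \<times> complex"

definition Rp :: "real measure" where
  "Rp = lebesgue_on {0<..}"

definition sqint :: "(real \<Rightarrow> complex) set" where
  "sqint = {g. g \<in> borel_measurable Rp \<and> integrable Rp (\<lambda>x. (cmod (g x))\<^sup>2)}"

definition L2 :: "vf set" where
  "L2 = {f. (\<lambda>x. fst (f x)) \<in> sqint \<and> (\<lambda>x. snd (f x)) \<in> sqint}"

definition aeq :: "vf \<Rightarrow> vf \<Rightarrow> bool" where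
  "aeq f g \<longleftrightarrow> (AE x in Rp. f x = g x)"

definition vzero :: vf where "vzero = (\<lambda>x. (0, 0))"

definition vadd :: "vf \<Rightarrow> vf \<Rightarrow> vf" where
  "vadd f g = (\<lambda>x. (fst (f x) + fst (g x), snd (f x) + snd (g x)))"

definition vsc :: "complex \<Rightarrow> vf \<Rightarrow> vf" where
  "vsc c f = (\<lambda>x. (c * fst (f x), c * snd (f x)))"

definition vdiff :: "vf \<Rightarrow> vf \<Rightarrow> vf" where
  "vdiff f g = vadd f (vsc (-1) g)"

definition ip :: "vf \<Rightarrow> vf \<Rightarrow> complex" where
  "ip f g = (\<integral>x. fst (f x) * cnj (fst (g x)) + snd (f x) * cnj (snd (g x)) \<partial>Rp)"

definition l2norm :: "vf \<Rightarrow> real" where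
  "l2norm f = sqrt (\<integral>x. (cmod (fst (f x)))\<^sup>2 + (cmod (snd (f x)))\<^sup>2 \<partial>Rp)"

definition lincomb :: "(nat \<Rightarrow> vf) \<Rightarrow> (nat \<Rightarrow> complex) \<Rightarrow> nat \<Rightarrow> vf" where
  "lincomb s c n = (\<lambda>x. (\<Sum>k<n. c k * fst (s k x), \<Sum>k<n. c k * snd (s k x)))"

definition cspan :: "(nat \<Rightarrow> vf) \<Rightarrow> vf set" where
  "cspan s = {f \<in> L2. \<forall>e>0. \<exists>c n. l2norm (vdiff f (lincomb s c n)) < e}"

text \<open>Scalar Sobolev data on R_+: u is (a.e.) u(0+) + int_0^x du, with u, du in L_2(R_+).
  Thus u in W_2^1(R_+), c is the boundary value lim_{x->0+} u(x) and du = u'.\<close>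
definition sob1 :: "(real \<Rightarrow> complex) \<Rightarrow> complex \<Rightarrow> (real \<Rightarrow> complex) \<Rightarrow> bool" where
  "sob1 u c du \<longleftrightarrow> u \<in> sqint \<and> du \<in> sqint \<and>
     (\<forall>x>0. integrable (lebesgue_on {0..x}) du) \<and>
     (AE x in Rp. u x = c + (\<integral>t. du t \<partial>(lebesgue_on {0..x})))"

definition vsob2 :: "vf \<Rightarrow> complex \<times> complex \<Rightarrow> vf \<Rightarrow> complex \<times> complex \<Rightarrow> vf \<Rightarrow> bool" where
  "vsob2 f c0 df c1 ddf \<longleftrightarrow>
     sob1 (\<lambda>x. fst (f x)) (fst c0) (\<lambda>x. fst (df x)) \<and>
     sob1 (\<lambda>x. snd (f x)) (snd c0) (\<lambda>x. snd (df x)) \<and>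
     sob1 (\<lambda>x. fst (df x)) (fst c1) (\<lambda>x. fst (ddf x)) \<and>
     sob1 (\<lambda>x. snd (df x)) (snd c1) (\<lambda>x. snd (ddf x))"

definition br_r :: "complex \<times> complex \<Rightarrow> complex" where
  "br_r c = (fst c + snd c) / 2"

definition br_s :: "complex \<times> complex \<Rightarrow> complex" where
  "br_s c = fst c - snd c"

definition Hrel :: "complex \<Rightarrow> vf \<Rightarrow> vf \<Rightarrow> vf \<Rightarrow> bool" where
  "Hrel a q f h \<longleftrightarrow> f \<in> L2 \<and> h \<in> L2 \<and>
     (\<exists>c0 df c1 ddf. vsob2 f c0 df c1 ddf \<and> br_s c0 = 0 \<and>
        br_r c1 = a * br_r c0 + ip f q \<and>
        aeq h (vadd (vsc (-1) ddf) (vsc (br_r c0) q)))"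

text \<open>Graph of T = (B - i)(B + i)^{-1}, B = i d/dx with u(0)=0, acting componentwise.\<close>
definition Trel :: "vf \<Rightarrow> vf \<Rightarrow> bool" where
  "Trel f g \<longleftrightarrow> f \<in> L2 \<and> g \<in> L2 \<and>
     (\<exists>u du. sob1 (\<lambda>x. fst (u x)) 0 (\<lambda>x. fst (du x)) \<and>
             sob1 (\<lambda>x. snd (u x)) 0 (\<lambda>x. snd (du x)) \<and>
             aeq f (vadd (vsc \<i> du) (vsc \<i> u)) \<and>
             aeq g (vdiff (vsc \<i> du) (vsc \<i> u)))"

definition Tadj :: "vf \<Rightarrow> vf \<Rightarrow> bool" where
  "Tadj f h \<longleftrightarrow> f \<in> L2 \<and> h \<in> L2 \<and> (\<forall>g g'. Trel g g' \<longrightarrow> ip g' f = ip g h)"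

definition Tadj_orbit :: "vf \<Rightarrow> (nat \<Rightarrow> vf) \<Rightarrow> bool" where
  "Tadj_orbit q s \<longleftrightarrow> aeq (s 0) q \<and> (\<forall>n. Tadj (s n) (s (Suc n)))"

definition noncyclic_Tadj :: "vf \<Rightarrow> bool" where
  "noncyclic_Tadj q \<longleftrightarrow> (\<exists>s. Tadj_orbit q s \<and> cspan s \<noteq> L2)"

definition closed_subspace :: "vf set \<Rightarrow> bool" where
  "closed_subspace H \<longleftrightarrow> H \<subseteq> L2 \<and> vzero \<in> H \<and>
     (\<forall>f\<in>H. \<forall>g\<in>H. vadd f g \<in> H) \<and> (\<forall>c. \<forall>f\<in>H. vsc c f \<in> H) \<and>
     (\<forall>f\<in>H. \<forall>g\<in>L2. aeq f g \<longrightarrow> g \<in> H) \<and>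
     (\<forall>s f. (\<forall>n. s n \<in> H) \<and> f \<in> L2 \<and> (\<lambda>n. l2norm (vdiff (s n) f)) \<longlonglongrightarrow> 0 \<longrightarrow> f \<in> H)"

definition is_operator :: "vf set \<Rightarrow> (vf \<times> vf) set \<Rightarrow> bool" where
  "is_operator H G \<longleftrightarrow> G \<subseteq> H \<times> H \<and> (vzero, vzero) \<in> G \<and>
     (\<forall>(u,v)\<in>G. \<forall>(u',v')\<in>G. (vadd u u', vadd v v') \<in> G) \<and>
     (\<forall>c. \<forall>(u,v)\<in>G. (vsc c u, vsc c v) \<in> G) \<and>
     (\<forall>(u,v)\<in>G. \<forall>u' v'. u' \<in> H \<and> v' \<in> H \<and> aeq u u' \<and> aeq v v' \<longrightarrow> (u',v') \<in> G) \<and>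
     (\<forall>(u,v)\<in>G. \<forall>(u',v')\<in>G. aeq u u' \<longrightarrow> aeq v v')"

definition dense_domain :: "vf set \<Rightarrow> (vf \<times> vf) set \<Rightarrow> bool" where
  "dense_domain H G \<longleftrightarrow> (\<forall>f\<in>H. \<forall>e>0. \<exists>(u,v)\<in>G. l2norm (vdiff f u) < e)"

definition symmetric_op :: "vf set \<Rightarrow> (vf \<times> vf) set \<Rightarrow> bool" where
  "symmetric_op H G \<longleftrightarrow> is_operator H G \<and> dense_domain H G \<and>
     (\<forall>(u,v)\<in>G. \<forall>(u',v')\<in>G. ip v u' = ip u v')"

definition maximal_symmetric :: "vf set \<Rightarrow> (vf \<times> vf) set \<Rightarrow> bool" where
  "maximal_symmetric H G \<longleftrightarrow> symmetric_op H G \<and>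
     (\<forall>G'. symmetric_op H G' \<and> G \<subseteq> G' \<longrightarrow> G' = G)"

definition selfadjoint_op :: "vf set \<Rightarrow> (vf \<times> vf) set \<Rightarrow> bool" where
  "selfadjoint_op H G \<longleftrightarrow> symmetric_op H G \<and>
     (\<forall>x\<in>H. \<forall>y\<in>H. (\<forall>(u,v)\<in>G. ip v x = ip u y) \<longrightarrow> (x,y) \<in> G)"

definition is_proj :: "vf set \<Rightarrow> vf \<Rightarrow> vf \<Rightarrow> bool" where
  "is_proj M u m \<longleftrightarrow> m \<in> M \<and> (\<forall>x\<in>M. ip (vdiff u m) x = 0)"

definition reducing :: "vf set \<Rightarrow> (vf \<times> vf) set \<Rightarrow> vf set \<Rightarrow> bool" where
  "reducing H G M \<longleftrightarrow> closed_subspace M \<and> M \<subseteq> H \<and>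
     (\<forall>(u,v)\<in>G. \<forall>m. is_proj M u m \<longrightarrow> (\<exists>w. (m,w) \<in> G \<and> is_proj M v w))"

definition simple_op :: "vf set \<Rightarrow> (vf \<times> vf) set \<Rightarrow> bool" where
  "simple_op H G \<longleftrightarrow> symmetric_op H G \<and>
     (\<forall>M. reducing H G M \<and> (\<exists>u\<in>M. \<not> aeq u vzero) \<longrightarrow>
        \<not> selfadjoint_op M (G \<inter> (M \<times> M)))"

definition op_sq :: "(vf \<times> vf) set \<Rightarrow> (vf \<times> vf) set" where
  "op_sq G = {(u,w). \<exists>v. (u,v) \<in> G \<and> (v,w) \<in> G}"

end

theory Submission
  imports Defs
begin

text \<open>
  Let \<open>(s\<^sub>n)\<close> be the orbit of \<open>q\<close> under the backward shift. Its orthogonal complement \<open>H\<close> is a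
  nonzero closed subspace invariant under \<open>T\<close>; let \<open>B\<close> be the part of \<open>\<B> = i d/dx\<close>, \<open>u(0) = 0\<close>, in
  \<open>H\<close>. If \<open>v = \<B>u\<close> and \<open>v + iu \<in> H\<close>, then also \<open>v - iu = T(v + iu) \<in> H\<close>, hence \<open>u\<close> and \<open>v\<close> lie in
  \<open>H\<close>. So \<open>B + i\<close> maps onto \<open>H\<close>, which gives density of the domain and maximality. An element \<open>u\<close> of
  the domain of the square of \<open>B\<close> satisfies \<open>u(0) = u'(0) = 0\<close> and is orthogonal to \<open>q = s\<^sub>0\<close>, so that
  all boundary conditions hold trivially.

  Simplicity: suppose that the part of \<open>B\<close> in \<open>N\<close> is self-adjoint. The function \<open>exp(-kx)\<close>, in
  either component, is orthogonal to the range of \<open>\<B> - ik\<close>, so its projection to \<open>N\<close> is an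
  eigenvector of the self-adjoint part for the eigenvalue \<open>-ik\<close> and therefore vanishes. Hence all
  exponential moments of elements of \<open>N\<close> vanish, and the Weierstrass theorem in the variable
  \<open>exp(-x)\<close> gives \<open>N = 0\<close>.
\<close>

section \<open>Inner product and norm\<close>

text \<open>Elements are functions and not classes, so completeness and projection are established
  directly for \<open>l2norm\<close>, in a form that also covers subspaces that are not closed: the
  domain of \<open>B\<close> and the linear span of the orbit both need it.

  Derivatives exist only almost everywhere. Hence calculus is phrased through primitives: the
  product rule comes from Fubini, and the boundary term at infinity vanishes because an integrable
  function that has a limit there has limit 0.

  That \<open>B + i\<close> maps onto \<open>H\<close> rests on two facts: \<open>u' + u = f\<close>
  has a square integrable solution for every square integrable \<open>f\<close>, and shift
  invariance returns the solution to \<open>H\<close>.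

  In the simplicity argument a general element of \<open>N\<close> is only square integrable,
  whereas Weierstrass requires a continuous function on \<open>[0,1]\<close>. The moment theorem is
  therefore applied to the domain of the self-adjoint part: its elements are continuous and tend to
  0 at infinity, up to null sets. Density of that domain then gives \<open>N = 0\<close>.\<close>

lemma sqint_measurable[measurable_dest]: "f \<in> sqint \<Longrightarrow> f \<in> borel_measurable Rp"
  by (simp add: sqint_def)

lemma sqint_integrable: "f \<in> sqint \<Longrightarrow> integrable Rp (\<lambda>x. (cmod (f x))\<^sup>2)"
  by (simp add: sqint_def)

lemma sqint_bound:
  assumes "g \<in> borel_measurable Rp" "integrable Rp h" "\<And>x. (cmod (g x))\<^sup>2 \<le> h x"
  shows "g \<in> sqint"
proof -
  have "norm ((cmod (g x))\<^sup>2) \<le> norm (h x)" for x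
    using assms(3)[of x] by (metis abs_ge_self norm_power order_trans power2_abs real_norm_def)
  then have "integrable Rp (\<lambda>x. (cmod (g x))\<^sup>2)"
    using assms(1) by (intro Bochner_Integration.integrable_bound[OF assms(2)]) auto
  then show ?thesis
    using assms(1) by (simp add: sqint_def)
qed

lemma two_mult_le_squares: "2 * (a * b) \<le> a\<^sup>2 + b\<^sup>2" for a b :: real
  using sum_squares_bound[of a b] by simp

lemma sqint_add:
  assumes f: "f \<in> sqint" and g: "g \<in> sqint"
  shows "(\<lambda>x. f x + g x) \<in> sqint"
proof (rule sqint_bound)
  show "(\<lambda>x. f x + g x) \<in> borel_measurable Rp"
    using f g by measurable
  show "integrable Rp (\<lambda>x. 2 * ((cmod (f x))\<^sup>2 + (cmod (g x))\<^sup>2))"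
    using f g by (intro integrable_mult_right Bochner_Integration.integrable_add sqint_integrable)
  fix x
  have "(cmod (f x + g x))\<^sup>2 \<le> (cmod (f x) + cmod (g x))\<^sup>2"
    by (intro power_mono norm_triangle_ineq norm_ge_zero)
  also have "\<dots> \<le> 2 * ((cmod (f x))\<^sup>2 + (cmod (g x))\<^sup>2)"
    using two_mult_le_squares[of "cmod (f x)" "cmod (g x)"] by (simp add: power2_sum)
  finally show "(cmod (f x + g x))\<^sup>2 \<le> 2 * ((cmod (f x))\<^sup>2 + (cmod (g x))\<^sup>2)" .
qed

lemma sqint_cmult:
  assumes "f \<in> sqint" shows "(\<lambda>x. c * f x) \<in> sqint"
proof (rule sqint_bound)
  show "(\<lambda>x. c * f x) \<in> borel_measurable Rp"
    using assms by measurable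
  show "integrable Rp (\<lambda>x. (cmod c)\<^sup>2 * (cmod (f x))\<^sup>2)"
    using assms by (intro integrable_mult_right sqint_integrable)
qed (simp add: norm_mult power_mult_distrib)

lemma measurable_cnj[measurable]: "cnj \<in> borel_measurable borel"
  by (intro borel_measurable_continuous_onI continuous_on_cnj continuous_on_id)

lemma sqint_cnj:
  assumes "f \<in> sqint" shows "(\<lambda>x. cnj (f x)) \<in> sqint"
proof (rule sqint_bound)
  show "(\<lambda>x. cnj (f x)) \<in> borel_measurable Rp"
    using assms by measurable
qed (use sqint_integrable[OF assms] in auto)

lemma sqint_mult_integrable:
  assumes f: "f \<in> sqint" and g: "g \<in> sqint"
  shows "integrable Rp (\<lambda>x. f x * g x)"
proof (rule Bochner_Integration.integrable_bound)
  show "integrable Rp (\<lambda>x. (cmod (f x))\<^sup>2 + (cmod (g x))\<^sup>2)"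
    using f g by (intro Bochner_Integration.integrable_add sqint_integrable)
  show "(\<lambda>x. f x * g x) \<in> borel_measurable Rp"
    using f g by measurable
  have "norm (f x * g x) \<le> norm ((cmod (f x))\<^sup>2 + (cmod (g x))\<^sup>2)" for x
  proof -
    have "0 \<le> cmod (f x) * cmod (g x)" by simp
    then have "cmod (f x) * cmod (g x) \<le> (cmod (f x))\<^sup>2 + (cmod (g x))\<^sup>2"
      using two_mult_le_squares[of "cmod (f x)" "cmod (g x)"] by linarith
    then show ?thesis by (simp add: norm_mult)
  qed
  then show "AE x in Rp. norm (f x * g x) \<le> norm ((cmod (f x))\<^sup>2 + (cmod (g x))\<^sup>2)"
    by auto
qed

lemma sqint_cong_AE:
  assumes "f \<in> sqint" "AE x in Rp. f x = g x" "g \<in> borel_measurable Rp"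
  shows "g \<in> sqint"
proof -
  have "integrable Rp (\<lambda>x. (cmod (g x))\<^sup>2)"
    using assms(1,3) by (intro integrable_cong_AE_imp[OF sqint_integrable[OF assms(1)]]) (use assms(2) in auto)
  then show ?thesis
    using assms(3) by (simp add: sqint_def)
qed

lemma L2_fst: "f \<in> L2 \<Longrightarrow> (\<lambda>x. fst (f x)) \<in> sqint"
  and L2_snd: "f \<in> L2 \<Longrightarrow> (\<lambda>x. snd (f x)) \<in> sqint"
  by (auto simp: L2_def)

lemma fst_vadd[simp]: "fst (vadd f g x) = fst (f x) + fst (g x)"
  and snd_vadd[simp]: "snd (vadd f g x) = snd (f x) + snd (g x)"
  and fst_vsc[simp]: "fst (vsc c f x) = c * fst (f x)"
  and snd_vsc[simp]: "snd (vsc c f x) = c * snd (f x)"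
  and fst_vdiff[simp]: "fst (vdiff f g x) = fst (f x) - fst (g x)"
  and snd_vdiff[simp]: "snd (vdiff f g x) = snd (f x) - snd (g x)"
  and fst_vzero[simp]: "fst (vzero x) = 0"
  and snd_vzero[simp]: "snd (vzero x) = 0"
  by (auto simp: vadd_def vsc_def vdiff_def vzero_def)

lemma L2_vadd: "f \<in> L2 \<Longrightarrow> g \<in> L2 \<Longrightarrow> vadd f g \<in> L2"
  by (simp add: L2_def sqint_add)

lemma L2_vsc: "f \<in> L2 \<Longrightarrow> vsc c f \<in> L2"
  by (simp add: L2_def sqint_cmult)

lemma L2_vdiff: "f \<in> L2 \<Longrightarrow> g \<in> L2 \<Longrightarrow> vdiff f g \<in> L2"
  by (simp add: vdiff_def L2_vadd L2_vsc)

lemma L2_vzero: "vzero \<in> L2"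
  by (simp add: L2_def sqint_def)

lemma ip_integrable:
  assumes "f \<in> L2" "g \<in> L2"
  shows "integrable Rp (\<lambda>x. fst (f x) * cnj (fst (g x)))"
    "integrable Rp (\<lambda>x. snd (f x) * cnj (snd (g x)))"
  using assms by (auto intro!: sqint_mult_integrable sqint_cnj L2_fst L2_snd)

lemma ip_split:
  assumes "f \<in> L2" "g \<in> L2"
  shows "ip f g = (\<integral>x. fst (f x) * cnj (fst (g x)) \<partial>Rp) + (\<integral>x. snd (f x) * cnj (snd (g x)) \<partial>Rp)"
  unfolding ip_def by (intro Bochner_Integration.integral_add ip_integrable assms)

lemma ip_add_left:
  assumes "f \<in> L2" "g \<in> L2" "h \<in> L2"
  shows "ip (vadd f g) h = ip f h + ip g h"
  using assms by (simp add: ip_split L2_vadd distrib_right ip_integrable)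

lemma ip_sc_left:
  assumes "f \<in> L2" "h \<in> L2"
  shows "ip (vsc c f) h = c * ip f h"
  using assms by (simp add: ip_split L2_vsc distrib_left mult.assoc)

lemma ip_cnj: "ip g f = cnj (ip f g)"
proof -
  have "cnj (ip f g) = (\<integral>x. cnj (fst (f x) * cnj (fst (g x)) + snd (f x) * cnj (snd (g x))) \<partial>Rp)"
    unfolding ip_def by (rule Bochner_Integration.integral_cnj[symmetric])
  then show ?thesis
    by (simp add: ip_def mult.commute)
qed

lemma ip_add_right:
  assumes "f \<in> L2" "g \<in> L2" "h \<in> L2"
  shows "ip h (vadd f g) = ip h f + ip h g"
  using ip_add_left[OF assms] by (metis ip_cnj complex_cnj_add)

lemma ip_sc_right:
  assumes "f \<in> L2" "h \<in> L2"
  shows "ip h (vsc c f) = cnj c * ip h f"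
  using ip_sc_left[OF assms] by (metis ip_cnj complex_cnj_mult)

lemma ip_diff_left:
  assumes "f \<in> L2" "g \<in> L2" "h \<in> L2"
  shows "ip (vdiff f g) h = ip f h - ip g h"
  using assms by (simp add: vdiff_def ip_add_left ip_sc_left L2_vsc)

lemma ip_diff_right:
  assumes "f \<in> L2" "g \<in> L2" "h \<in> L2"
  shows "ip h (vdiff f g) = ip h f - ip h g"
  using assms by (simp add: vdiff_def ip_add_right ip_sc_right L2_vsc)

lemma ip_vzero_left[simp]: "ip vzero f = 0"
  by (simp add: ip_def)

lemma ip_vzero_right[simp]: "ip f vzero = 0"
  by (simp add: ip_def)

lemmas ip_simps = ip_add_left ip_sc_left ip_add_right ip_sc_right ip_diff_left ip_diff_right
  L2_vadd L2_vsc L2_vdiff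

lemma vf_measurable_fst: "f \<in> L2 \<Longrightarrow> (\<lambda>x. fst (f x)) \<in> borel_measurable Rp"
  and vf_measurable_snd: "f \<in> L2 \<Longrightarrow> (\<lambda>x. snd (f x)) \<in> borel_measurable Rp"
  by (auto dest: L2_fst L2_snd sqint_measurable)

lemma ip_cong:
  assumes "aeq f f'" "aeq g g'" "f \<in> L2" "f' \<in> L2" "g \<in> L2" "g' \<in> L2"
  shows "ip f g = ip f' g'"
proof -
  note [measurable] = vf_measurable_fst[OF assms(3)] vf_measurable_fst[OF assms(4)]
    vf_measurable_fst[OF assms(5)] vf_measurable_fst[OF assms(6)]
    vf_measurable_snd[OF assms(3)] vf_measurable_snd[OF assms(4)]
    vf_measurable_snd[OF assms(5)] vf_measurable_snd[OF assms(6)]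
  show ?thesis
    unfolding ip_def
  proof (rule integral_cong_AE)
    show "AE x in Rp. fst (f x) * cnj (fst (g x)) + snd (f x) * cnj (snd (g x)) =
      fst (f' x) * cnj (fst (g' x)) + snd (f' x) * cnj (snd (g' x))"
      using assms(1,2) unfolding aeq_def by eventually_elim simp
  qed measurable
qed

lemma l2norm_nonneg[simp]: "0 \<le> l2norm f"
  unfolding l2norm_def by (intro real_sqrt_ge_zero Bochner_Integration.integral_nonneg) auto

lemma l2norm_sq: "(l2norm f)\<^sup>2 = (\<integral>x. (cmod (fst (f x)))\<^sup>2 + (cmod (snd (f x)))\<^sup>2 \<partial>Rp)"
  unfolding l2norm_def by (intro real_sqrt_pow2 Bochner_Integration.integral_nonneg) auto

lemma ip_self: "ip f f = complex_of_real ((l2norm f)\<^sup>2)"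
proof -
  have "ip f f = (\<integral>x. complex_of_real ((cmod (fst (f x)))\<^sup>2 + (cmod (snd (f x)))\<^sup>2) \<partial>Rp)"
    unfolding ip_def of_real_add complex_norm_square ..
  then show ?thesis
    by (simp only: integral_complex_of_real l2norm_sq)
qed

lemma l2norm_sq_Re: "(l2norm f)\<^sup>2 = Re (ip f f)"
  by (simp add: ip_self)

lemma l2norm_integrable:
  assumes "f \<in> L2" 
  shows "integrable Rp (\<lambda>x. (cmod (fst (f x)))\<^sup>2 + (cmod (snd (f x)))\<^sup>2)"
  using assms by (intro Bochner_Integration.integrable_add sqint_integrable L2_fst L2_snd)

lemma l2norm_eq_0_iff:
  assumes "f \<in> L2" shows "l2norm f = 0 \<longleftrightarrow> aeq f vzero"
proof -
  have "l2norm f = 0 \<longleftrightarrow> (\<integral>x. (cmod (fst (f x)))\<^sup>2 + (cmod (snd (f x)))\<^sup>2 \<partial>Rp) = 0"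
    using l2norm_sq[of f] by auto
  also have "\<dots> \<longleftrightarrow> (AE x in Rp. (cmod (fst (f x)))\<^sup>2 + (cmod (snd (f x)))\<^sup>2 = 0)"
    by (rule integral_nonneg_eq_0_iff_AE[OF l2norm_integrable[OF assms]]) simp
  also have "\<dots> \<longleftrightarrow> aeq f vzero"
    by (simp add: aeq_def vzero_def sum_power2_eq_zero_iff prod_eq_iff)
  finally show ?thesis .
qed

lemma l2norm_cong:
  assumes "aeq f g" "f \<in> L2" "g \<in> L2" shows "l2norm f = l2norm g"
proof -
  have "(l2norm f)\<^sup>2 = (l2norm g)\<^sup>2"
    unfolding l2norm_sq_Re using ip_cong[OF assms(1,1,2,3,2,3)] by simp
  then show ?thesis by simp
qed

lemma aeq_refl[simp]: "aeq f f" and aeq_sym: "aeq f g \<Longrightarrow> aeq g f"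
  by (auto simp: aeq_def)

lemma aeq_vdiff_iff: "aeq (vdiff f g) vzero \<longleftrightarrow> aeq f g"
  by (simp add: aeq_def prod_eq_iff)

lemma aeq_vadd: "aeq f f' \<Longrightarrow> aeq g g' \<Longrightarrow> aeq (vadd f g) (vadd f' g')"
  unfolding aeq_def vadd_def by (auto elim: eventually_elim2)

lemma aeq_vsc: "aeq f f' \<Longrightarrow> aeq (vsc c f) (vsc c f')"
  unfolding aeq_def vsc_def by (erule AE_mp) simp

lemma aeq_vdiff: "aeq f f' \<Longrightarrow> aeq g g' \<Longrightarrow> aeq (vdiff f g) (vdiff f' g')"
  unfolding vdiff_def by (intro aeq_vadd aeq_vsc)

lemma l2norm_vsc: "f \<in> L2 \<Longrightarrow> l2norm (vsc c f) = cmod c * l2norm f"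
proof -
  assume f: "f \<in> L2"
  have "ip (vsc c f) (vsc c f) = complex_of_real ((cmod c * l2norm f)\<^sup>2)"
    using f unfolding power_mult_distrib of_real_mult complex_norm_square
    by (simp add: ip_simps ip_self[of f])
  then have "(l2norm (vsc c f))\<^sup>2 = (cmod c * l2norm f)\<^sup>2"
    unfolding l2norm_sq_Re by simp
  then show ?thesis by simp
qed

lemma l2norm_add_sq:
  assumes "f \<in> L2" "g \<in> L2"
  shows "(l2norm (vadd f g))\<^sup>2 = (l2norm f)\<^sup>2 + (l2norm g)\<^sup>2 + 2 * Re (ip f g)"
proof -
  have "Re (ip g f) = Re (ip f g)" by (subst ip_cnj) simp
  then show ?thesis
    using assms by (simp add: l2norm_sq_Re ip_simps)
qed

lemma l2norm_diff_sq:
  assumes "f \<in> L2" "g \<in> L2"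
  shows "(l2norm (vdiff f g))\<^sup>2 = (l2norm f)\<^sup>2 + (l2norm g)\<^sup>2 - 2 * Re (ip f g)"
proof -
  have "Re (ip g f) = Re (ip f g)" by (subst ip_cnj) simp
  then show ?thesis
    using assms by (simp add: l2norm_sq_Re ip_simps)
qed

lemma vf_eqI: "(\<And>x. fst (f x) = fst (g x)) \<Longrightarrow> (\<And>x. snd (f x) = snd (g x)) \<Longrightarrow> f = (g :: vf)"
  by (auto intro!: ext prod_eqI)

lemma ip_Cauchy_Schwarz:
  assumes f: "f \<in> L2" and g: "g \<in> L2"
  shows "cmod (ip f g) \<le> l2norm f * l2norm g"
proof (cases "l2norm g = 0")
  case True
  then have "ip f g = ip f vzero"
    using f g l2norm_eq_0_iff by (intro ip_cong) (auto simp: L2_vzero)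
  then show ?thesis by simp
next
  case False
  define N where "N = (l2norm g)\<^sup>2"
  have N: "N > 0" using False by (simp add: N_def)
  have eq: "ip f g * ip g f = complex_of_real ((cmod (ip f g))\<^sup>2)"
    unfolding complex_norm_square by (subst (2) ip_cnj) simp
  \<comment> \<open>The vector is \<open>N\<close> times the component of \<open>f\<close>
    orthogonal to \<open>g\<close>; scaling by \<open>N\<close> instead of dividing keeps the
    expansion polynomial.\<close>
  have "0 \<le> (l2norm (vdiff (vsc N f) (vsc (ip f g) g)))\<^sup>2" by simp
  also have "\<dots> = Re (of_real N * (of_real N * ip f f) - cnj (ip f g) * ip f g * of_real N
      - of_real N * (ip f g * ip g f) + cnj (ip f g) * ip f g * of_real N)"
    using f g unfolding l2norm_sq_Re
    by (simp add: ip_simps ip_self[of g] N_def[symmetric] algebra_simps)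
  also have "\<dots> = N * (N * (l2norm f)\<^sup>2 - (cmod (ip f g))\<^sup>2)"
    unfolding eq ip_self by (simp add: algebra_simps)
  finally have "(cmod (ip f g))\<^sup>2 \<le> N * (l2norm f)\<^sup>2"
    using N by (simp add: zero_le_mult_iff)
  then have "(cmod (ip f g))\<^sup>2 \<le> (l2norm f * l2norm g)\<^sup>2"
    by (simp add: N_def power_mult_distrib mult.commute)
  then show ?thesis
    by (rule power2_le_imp_le) simp
qed

lemma l2norm_triangle:
  assumes f: "f \<in> L2" and g: "g \<in> L2"
  shows "l2norm (vadd f g) \<le> l2norm f + l2norm g"
proof (rule power2_le_imp_le)
  have "Re (ip f g) \<le> l2norm f * l2norm g"
    using ip_Cauchy_Schwarz[OF f g] complex_Re_le_cmod[of "ip f g"] by linarith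
  then show "(l2norm (vadd f g))\<^sup>2 \<le> (l2norm f + l2norm g)\<^sup>2"
    using l2norm_add_sq[OF f g] by (simp add: power2_sum)
qed simp

lemma l2norm_vdiff_commute: 
  assumes f: "f \<in> L2" and g: "g \<in> L2"
  shows "l2norm (vdiff f g) = l2norm (vdiff g f)"
proof -
  have "vdiff f g = vsc (-1) (vdiff g f)" by (rule vf_eqI) auto
  then show ?thesis using l2norm_vsc[OF L2_vdiff[OF g f], of "-1"] by simp
qed

lemma l2norm_vdiff_triangle:
  assumes f: "f \<in> L2" and g: "g \<in> L2" and h: "h \<in> L2"
  shows "l2norm (vdiff f h) \<le> l2norm (vdiff f g) + l2norm (vdiff g h)"
proof -
  have "vdiff f h = vadd (vdiff f g) (vdiff g h)" by (rule vf_eqI) auto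
  then show ?thesis using l2norm_triangle[OF L2_vdiff[OF f g] L2_vdiff[OF g h]] by simp
qed

section \<open>Completeness and orthogonal projection\<close>

lemma nn_integral_l2norm:
  assumes "f \<in> L2"
  shows "(\<integral>\<^sup>+x. ennreal ((norm (f x))\<^sup>2) \<partial>Rp) = ennreal ((l2norm f)\<^sup>2)"
proof -
  have eq: "(norm (f x))\<^sup>2 = (cmod (fst (f x)))\<^sup>2 + (cmod (snd (f x)))\<^sup>2" for x
    by (simp add: norm_prod_def)
  show ?thesis
    unfolding eq l2norm_sq by (rule nn_integral_eq_integral[OF l2norm_integrable[OF assms]]) simp
qed

lemma L2_measurable: "f \<in> L2 \<Longrightarrow> f \<in> borel_measurable Rp"
proof -
  assume f: "f \<in> L2"
  have "(\<lambda>x. (fst (f x), snd (f x))) \<in> borel_measurable Rp"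
    by (intro borel_measurable_Pair vf_measurable_fst vf_measurable_snd f)
  then show ?thesis by simp
qed

lemma L2_I:
  assumes m: "f \<in> borel_measurable Rp" and fin: "(\<integral>\<^sup>+x. ennreal ((norm (f x))\<^sup>2) \<partial>Rp) < \<infinity>"
  shows "f \<in> L2"
proof -
  have int: "integrable Rp (\<lambda>x. (norm (f x))\<^sup>2)"
    using m fin by (intro integrableI_bounded) auto
  have "fst \<in> borel_measurable (borel :: (complex \<times> complex) measure)"
    "snd \<in> borel_measurable (borel :: (complex \<times> complex) measure)"
    by (auto intro!: borel_measurable_continuous_onI continuous_intros)
  from measurable_compose[OF m this(1)] measurable_compose[OF m this(2)] 
  have "(\<lambda>x. fst (f x)) \<in> borel_measurable Rp" "(\<lambda>x. snd (f x)) \<in> borel_measurable Rp"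
    by auto
  then have "(\<lambda>x. fst (f x)) \<in> sqint" "(\<lambda>x. snd (f x)) \<in> sqint"
    by (auto intro!: sqint_bound[OF _ int] simp: norm_prod_def)
  then show ?thesis by (simp add: L2_def)
qed

lemma vdiff_eq: "vdiff f g = (\<lambda>x. f x - g x)"
  by (rule vf_eqI) auto

text \<open>The terms of a summable series are eventually below 1, so \<open>norm (d n)\<close> is
  eventually dominated by \<open>(1/2) ^ n\<close>. Squares are the natural input, since integrating
  squared norms over the half-line gives the squared \<open>l2norm\<close>.\<close>

lemma summable_of_weighted_squares:
  fixes d :: "nat \<Rightarrow> 'a::banach"
  assumes "summable (\<lambda>n. 4 ^ n * (norm (d n))\<^sup>2)"
  shows "summable d"
proof -
  have "(\<lambda>n. 4 ^ n * (norm (d n))\<^sup>2) \<longlonglongrightarrow> 0"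
    using assms by (rule summable_LIMSEQ_zero)
  then have "eventually (\<lambda>n. 4 ^ n * (norm (d n))\<^sup>2 < 1) sequentially"
    by (rule order_tendstoD(2)) simp
  then have "eventually (\<lambda>n. norm (d n) \<le> (1/2) ^ n) sequentially"
  proof eventually_elim
    case (elim n)
    have "(2 ^ n * norm (d n))\<^sup>2 \<le> 1\<^sup>2"
      using elim by (simp add: power_mult_distrib power2_eq_square[of "2 ^ n"] flip: power_mult_distrib[of 2 2])
    then have "2 ^ n * norm (d n) \<le> 1"
      by (rule power2_le_imp_le) simp
    then show ?case by (simp add: field_simps)
  qed
  then show ?thesis
    by (rule summable_comparison_test_ev) (simp add: summable_geometric)
qed

lemma fast_Cauchy_bound:
  assumes s: "\<And>n. s n \<in> L2" and fast: "\<And>n. l2norm (vdiff (s (Suc n)) (s n)) \<le> (1/4) ^ n"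
  shows "l2norm (vdiff (s (n + j)) (s n)) \<le> 2 * (1/4) ^ n"
proof -
  \<comment> \<open>The induction needs a bound that reserves room for later increments: passing
    from \<open>j\<close> to \<open>Suc j\<close> costs \<open>(1/4) ^ (n + j)\<close>, while the
    subtracted term shrinks by 3/2 of that.\<close>
  have "l2norm (vdiff (s (n + j)) (s n)) \<le> 2 * (1/4) ^ n - 2 * (1/4) ^ (n + j)"
  proof (induction j)
    case 0
    have "vdiff (s n) (s n) = vzero" by (rule vf_eqI) auto
    then show ?case by (simp add: l2norm_def vzero_def)
  next
    case (Suc j)
    have "l2norm (vdiff (s (n + Suc j)) (s n))
      \<le> l2norm (vdiff (s (Suc (n + j))) (s (n + j))) + l2norm (vdiff (s (n + j)) (s n))"
      using l2norm_vdiff_triangle[OF s s s] by simp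
    also have "\<dots> \<le> (1/4) ^ (n + j) + (2 * (1/4) ^ n - 2 * (1/4) ^ (n + j))"
      by (intro add_mono fast Suc.IH)
    also have "\<dots> \<le> 2 * (1/4) ^ n - 2 * (1/4) ^ (n + Suc j)" by simp
    finally show ?case .
  qed
  also have "\<dots> \<le> 2 * (1/4) ^ n" by simp
  finally show ?thesis .
qed

text \<open>The weights \<open>4\<^sup>n\<close> make the squared increments summable almost everywhere, which forces pointwise
  geometric convergence; Fatou then turns the pointwise limit into a norm limit.\<close>

lemma L2_complete_fast:
  assumes s: "\<And>n. s n \<in> L2" and fast: "\<And>n. l2norm (vdiff (s (Suc n)) (s n)) \<le> (1/4) ^ n"
  shows "\<exists>f\<in>L2. (\<lambda>n. l2norm (vdiff (s n) f)) \<longlonglongrightarrow> 0"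
proof -
  define d where "d n = vdiff (s (Suc n)) (s n)" for n
  have dL: "d n \<in> L2" for n by (simp add: d_def L2_vdiff s)
  note [measurable] = L2_measurable[OF s] L2_measurable[OF dL]
  have "(\<integral>\<^sup>+x. (\<Sum>n. ennreal (4 ^ n * (norm (d n x))\<^sup>2)) \<partial>Rp)
    = (\<Sum>n. \<integral>\<^sup>+x. ennreal (4 ^ n * (norm (d n x))\<^sup>2) \<partial>Rp)"
    by (intro nn_integral_suminf) measurable
  also have "\<dots> \<le> (\<Sum>n. ennreal ((1/4) ^ n))"
  proof (intro suminf_le)
    fix n
    have "(\<integral>\<^sup>+x. ennreal (4 ^ n * (norm (d n x))\<^sup>2) \<partial>Rp) = ennreal (4 ^ n) * ennreal ((l2norm (d n))\<^sup>2)"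
      by (simp add: ennreal_mult nn_integral_cmult nn_integral_l2norm[OF dL, symmetric])
    also have "\<dots> = ennreal (4 ^ n * (l2norm (d n))\<^sup>2)" by (simp add: ennreal_mult)
    also have "\<dots> \<le> ennreal ((1/4) ^ n)"
    proof (rule ennreal_leI)
      have "(l2norm (d n))\<^sup>2 \<le> ((1/4) ^ n)\<^sup>2"
        using fast by (intro power_mono) (auto simp: d_def)
      then have "4 ^ n * (l2norm (d n))\<^sup>2 \<le> 4 ^ n * ((1/4) ^ n)\<^sup>2" by simp
      also have "\<dots> = (1/4) ^ n" by (simp add: power2_eq_square power_divide)
      finally show "4 ^ n * (l2norm (d n))\<^sup>2 \<le> (1/4) ^ n" .
    qed
    finally show "(\<integral>\<^sup>+x. ennreal (4 ^ n * (norm (d n x))\<^sup>2) \<partial>Rp) \<le> ennreal ((1/4) ^ n)" .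
  qed auto
  also have "\<dots> < \<infinity>"
    by (simp add: suminf_ennreal2 summable_geometric)
  finally have "AE x in Rp. (\<Sum>n. ennreal (4 ^ n * (norm (d n x))\<^sup>2)) \<noteq> \<infinity>"
    by (intro nn_integral_noteq_infinite) auto
  then have conv: "AE x in Rp. (\<lambda>n. s n x) \<longlonglongrightarrow> lim (\<lambda>n. s n x)"
  proof eventually_elim
    case (elim x)
    then have "summable (\<lambda>n. 4 ^ n * (norm (d n x))\<^sup>2)"
      by (intro summable_suminf_not_top) auto
    then have "summable (\<lambda>n. s (Suc n) x - s n x)"
      using summable_of_weighted_squares[of "\<lambda>n. d n x"] by (simp add: d_def vdiff_eq)
    then have "convergent (\<lambda>n. \<Sum>k<n. s (Suc k) x - s k x)"
      by (simp add: summable_iff_convergent)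
    then have "convergent (\<lambda>n. s n x - s 0 x)"
      by (simp add: sum_lessThan_telescope[of "\<lambda>n. s n x"])
    then have "convergent (\<lambda>n. s n x)"
      using convergent_add[of "\<lambda>n. s n x - s 0 x" "\<lambda>n. s 0 x"] by (simp add: convergent_const)
    then show ?case by (simp add: convergent_LIMSEQ_iff)
  qed
  define f where "f x = lim (\<lambda>n. s n x)" for x
  have [measurable]: "f \<in> borel_measurable Rp"
    unfolding f_def by measurable
  have bnd: "(\<integral>\<^sup>+x. ennreal ((norm (vdiff f (s n) x))\<^sup>2) \<partial>Rp) \<le> ennreal ((2 * (1/4) ^ n)\<^sup>2)" for n
  proof -
    have "(\<integral>\<^sup>+x. ennreal ((norm (vdiff f (s n) x))\<^sup>2) \<partial>Rp)
      = (\<integral>\<^sup>+x. liminf (\<lambda>j. ennreal ((norm (vdiff (s (n + j)) (s n) x))\<^sup>2)) \<partial>Rp)"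
    proof (rule nn_integral_cong_AE, use conv in eventually_elim)
      case (elim x)
      then have "(\<lambda>j. s (n + j) x) \<longlonglongrightarrow> f x"
        unfolding f_def[symmetric] using LIMSEQ_ignore_initial_segment[of "\<lambda>j. s j x" "f x" n]
        by (simp add: add.commute)
      then have "(\<lambda>j. ennreal ((norm (s (n + j) x - s n x))\<^sup>2)) \<longlonglongrightarrow> ennreal ((norm (f x - s n x))\<^sup>2)"
        by (intro tendsto_intros)
      then show ?case
        unfolding vdiff_eq by (rule lim_imp_Liminf[OF sequentially_bot, symmetric])
    qed
    also have "\<dots> \<le> liminf (\<lambda>j. \<integral>\<^sup>+x. ennreal ((norm (vdiff (s (n + j)) (s n) x))\<^sup>2) \<partial>Rp)"
      unfolding vdiff_eq by (intro nn_integral_liminf) measurable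
    also have "\<dots> \<le> ennreal ((2 * (1/4) ^ n)\<^sup>2)"
    proof (rule Liminf_le)
      show "\<forall>\<^sub>F j in sequentially. (\<integral>\<^sup>+x. ennreal ((norm (vdiff (s (n + j)) (s n) x))\<^sup>2) \<partial>Rp)
          \<le> ennreal ((2 * (1/4) ^ n)\<^sup>2)"
        unfolding nn_integral_l2norm[OF L2_vdiff[OF s s]]
        using fast_Cauchy_bound[OF s fast]
        by (intro always_eventually allI ennreal_leI power_mono) auto
    qed simp
    finally show ?thesis .
  qed
  \<comment> \<open>Fatou bounds only the differences, as nothing is known yet about the norm of
    \<open>f\<close>; adding back \<open>s 0\<close> then puts \<open>f\<close> itself into
    \<open>L2\<close>.\<close>
  have dfL: "vdiff f (s n) \<in> L2" for n
  proof (rule L2_I)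
    show "vdiff f (s n) \<in> borel_measurable Rp" unfolding vdiff_eq by measurable
    show "(\<integral>\<^sup>+x. ennreal ((norm (vdiff f (s n) x))\<^sup>2) \<partial>Rp) < \<infinity>"
      using bnd[of n] by (rule order_le_less_trans) simp
  qed
  have "f = vadd (vdiff f (s 0)) (s 0)" by (rule vf_eqI) auto
  then have fL: "f \<in> L2" using L2_vadd[OF dfL s] by metis
  have "l2norm (vdiff (s n) f) \<le> 2 * (1/4) ^ n" for n
  proof (rule power2_le_imp_le)
    show "(l2norm (vdiff (s n) f))\<^sup>2 \<le> (2 * (1/4) ^ n)\<^sup>2"
      using bnd[of n] unfolding nn_integral_l2norm[OF dfL] l2norm_vdiff_commute[OF s fL]
      by (simp add: ennreal_le_iff)
  qed simp
  then have "\<forall>\<^sub>F n in sequentially. norm (l2norm (vdiff (s n) f)) \<le> 2 * (1/4) ^ n"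
    by (intro always_eventually) simp
  moreover have "(\<lambda>n. 2 * (1/4::real) ^ n) \<longlonglongrightarrow> 0"
    by (intro tendsto_mult_right_zero LIMSEQ_power_zero) simp
  ultimately have "(\<lambda>n. l2norm (vdiff (s n) f)) \<longlonglongrightarrow> 0"
    by (rule Lim_null_comparison)
  with fL show ?thesis by blast
qed

text \<open>With \<open>c = (w,v) / |v|^2\<close> the quadratic \<open>|w - cv|^2\<close> drops
  below \<open>|w|^2\<close> by \<open>|(w,v)|^2 / |v|^2\<close>, and the drop cannot exceed the
  slack \<open>e\<close>. An approximate version is needed because the infimum over a subspace that
  is not closed may not be attained.\<close>

lemma almost_minimal_almost_orthogonal:
  assumes w: "w \<in> L2" and v: "v \<in> L2" and min: "\<And>c. D \<le> (l2norm (vdiff w (vsc c v)))\<^sup>2"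
    and le: "(l2norm w)\<^sup>2 \<le> D + e"
  shows "(cmod (ip w v))\<^sup>2 \<le> e * (l2norm v)\<^sup>2"
proof (cases "l2norm v = 0")
  case True
  then show ?thesis using ip_Cauchy_Schwarz[OF w v] by simp
next
  case False
  define N where "N = (l2norm v)\<^sup>2"
  have N: "N > 0" using False by (simp add: N_def)
  define c where "c = ip w v / N"
  have "D \<le> (l2norm (vdiff w (vsc c v)))\<^sup>2" by (rule min)
  also have "\<dots> = (l2norm w)\<^sup>2 + (cmod c)\<^sup>2 * N - 2 * Re (cnj c * ip w v)"
    using w v by (simp add: l2norm_diff_sq L2_vsc l2norm_vsc ip_simps N_def power_mult_distrib)
  also have "cnj c * ip w v = of_real ((cmod (ip w v))\<^sup>2 / N)"
    unfolding c_def of_real_divide complex_norm_square by simp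
  also have "(cmod c)\<^sup>2 * N = (cmod (ip w v))\<^sup>2 / N"
    using N by (simp add: c_def norm_divide power_divide power2_eq_square)
  finally have "(cmod (ip w v))\<^sup>2 / N \<le> e"
    using le by simp
  then show ?thesis
    using N by (simp add: N_def[symmetric] field_simps)
qed

text \<open>\<open>V\<close> need not be closed: the projection \<open>p\<close> is onto its
  closure, and the sequence from \<open>V\<close> records that \<open>p\<close> lies there. This one
  form serves closed subspaces, the domain of \<open>B\<close> and the span of an orbit.\<close>

lemma L2_projection:
  assumes VL: "V \<subseteq> L2" and V0: "vzero \<in> V"
    and Va: "\<And>f g. f \<in> V \<Longrightarrow> g \<in> V \<Longrightarrow> vadd f g \<in> V"
    and Vs: "\<And>c f. f \<in> V \<Longrightarrow> vsc c f \<in> V"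
    and f: "f \<in> L2"
  shows "\<exists>p s. p \<in> L2 \<and> (\<forall>n::nat. s n \<in> V) \<and> (\<lambda>n. l2norm (vdiff (s n) p)) \<longlonglongrightarrow> 0
    \<and> (\<forall>v\<in>V. ip (vdiff f p) v = 0)"
proof -
  define D where "D = (INF v\<in>V. (l2norm (vdiff f v))\<^sup>2)"
  have bdd: "bdd_below ((\<lambda>v. (l2norm (vdiff f v))\<^sup>2) ` V)"
    by (rule bdd_belowI[of _ 0]) auto
  have D_le: "D \<le> (l2norm (vdiff f v))\<^sup>2" if "v \<in> V" for v
    unfolding D_def by (rule cINF_lower[OF bdd that])
  \<comment> \<open>The parallelogram law below turns a slack of \<open>e n\<close> into a squared
    increment of at most \<open>4 * e n\<close>; the choice makes this
    \<open>((1/4) ^ n)\<^sup>2\<close>, the rate demanded by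
    \<open>L2_complete_fast\<close>.\<close>
  define e where "e n = (1/16::real) ^ n / 4" for n :: nat
  have e_pos: "e n > 0" for n by (simp add: e_def)
  have "\<exists>v\<in>V. (l2norm (vdiff f v))\<^sup>2 < D + e n" for n
  proof -
    have "D < D + e n" using e_pos[of n] by simp
    then show ?thesis
      unfolding D_def using cINF_less_iff[OF _ bdd] V0 by (metis empty_iff)
  qed
  then obtain s where sV: "\<And>n. s n \<in> V" and s_le: "\<And>n. (l2norm (vdiff f (s n)))\<^sup>2 < D + e n"
    by metis
  have sL: "s n \<in> L2" for n using sV VL by blast
  have fast: "l2norm (vdiff (s (Suc n)) (s n)) \<le> (1/4) ^ n" for n
  proof (rule power2_le_imp_le)
    let ?a = "vdiff f (s n)" and ?b = "vdiff f (s (Suc n))"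
    let ?m = "vsc (1/2) (vadd (s n) (s (Suc n)))"
    have L: "?a \<in> L2" "?b \<in> L2" using f sL by (auto intro: L2_vdiff)
    have mV: "?m \<in> V" by (intro Vs Va sV)
    have e1: "vdiff (s (Suc n)) (s n) = vdiff ?a ?b" by (rule vf_eqI) auto
    have e2: "vadd ?a ?b = vsc 2 (vdiff f ?m)" by (rule vf_eqI) (auto simp: algebra_simps)
    \<comment> \<open>Parallelogram law; the midpoint \<open>?m\<close> lies in \<open>V\<close>, so
      its squared distance to \<open>f\<close> is at least \<open>D\<close>.\<close>
    have "(l2norm (vdiff ?a ?b))\<^sup>2 + (l2norm (vadd ?a ?b))\<^sup>2 = 2 * (l2norm ?a)\<^sup>2 + 2 * (l2norm ?b)\<^sup>2"
      using l2norm_diff_sq[OF L] l2norm_add_sq[OF L] by simp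
    moreover have "(l2norm (vadd ?a ?b))\<^sup>2 = 4 * (l2norm (vdiff f ?m))\<^sup>2"
      unfolding e2 using f mV VL by (subst l2norm_vsc) (auto intro!: L2_vdiff simp: power_mult_distrib)
    moreover have "4 * D \<le> 4 * (l2norm (vdiff f ?m))\<^sup>2" using D_le[OF mV] by simp
    moreover have "e (Suc n) \<le> e n" by (simp add: e_def)
    ultimately have "(l2norm (vdiff ?a ?b))\<^sup>2 \<le> 4 * e n"
      using s_le[of n] s_le[of "Suc n"] by linarith
    also have "\<dots> = ((1/4) ^ n)\<^sup>2"
      by (simp add: e_def power_divide power2_eq_square flip: power_mult_distrib)
    finally show "(l2norm (vdiff (s (Suc n)) (s n)))\<^sup>2 \<le> ((1/4) ^ n)\<^sup>2" unfolding e1 .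
  qed simp
  obtain p where pL: "p \<in> L2" and lim: "(\<lambda>n. l2norm (vdiff (s n) p)) \<longlonglongrightarrow> 0"
    using L2_complete_fast[OF sL fast] by blast
  have "ip (vdiff f p) v = 0" if v: "v \<in> V" for v
  proof -
    have vL: "v \<in> L2" using v VL by blast
    \<comment> \<open>Orthogonality is reached through the approximants: the first term comes from
      the almost minimality of \<open>s n\<close>, the second from Cauchy-Schwarz.\<close>
    have est: "cmod (ip (vdiff f p) v) \<le> sqrt (e n) * l2norm v + l2norm (vdiff (s n) p) * l2norm v" for n
    proof -
      have "(cmod (ip (vdiff f (s n)) v))\<^sup>2 \<le> e n * (l2norm v)\<^sup>2"
      proof (rule almost_minimal_almost_orthogonal)
        fix c
        have "vdiff (vdiff f (s n)) (vsc c v) = vdiff f (vadd (s n) (vsc c v))"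
          by (rule vf_eqI) auto
        then show "D \<le> (l2norm (vdiff (vdiff f (s n)) (vsc c v)))\<^sup>2"
          using D_le[OF Va[OF sV Vs[OF v]]] by simp
      qed (use f sL vL s_le[of n] in \<open>auto intro: L2_vdiff\<close>)
      also have "\<dots> = (sqrt (e n) * l2norm v)\<^sup>2"
        using e_pos[of n] by (simp add: power_mult_distrib)
      finally have "cmod (ip (vdiff f (s n)) v) \<le> sqrt (e n) * l2norm v"
        by (rule power2_le_imp_le) (use e_pos[of n] in simp)
      moreover have "ip (vdiff f p) v = ip (vdiff f (s n)) v + ip (vdiff (s n) p) v"
        using f sL pL vL by (simp add: ip_simps)
      moreover have "cmod (ip (vdiff (s n) p) v) \<le> l2norm (vdiff (s n) p) * l2norm v"
        by (intro ip_Cauchy_Schwarz L2_vdiff sL pL vL)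
      ultimately show ?thesis
        by (metis add_mono norm_triangle_mono)
    qed
    have "(\<lambda>n. (1/16::real) ^ n) \<longlonglongrightarrow> 0" by (rule LIMSEQ_power_zero) simp
    then have "e \<longlonglongrightarrow> 0"
      unfolding e_def using tendsto_divide[of "\<lambda>n. (1/16::real) ^ n" 0 _ "\<lambda>_. 4" 4] by auto
    then have "(\<lambda>n. sqrt (e n)) \<longlonglongrightarrow> 0"
      using tendsto_real_sqrt[of e 0] by simp
    then have "(\<lambda>n. sqrt (e n) * l2norm v + l2norm (vdiff (s n) p) * l2norm v) \<longlonglongrightarrow> 0 * l2norm v + 0 * l2norm v"
      by (intro tendsto_intros lim)
    then have "cmod (ip (vdiff f p) v) \<le> 0 * l2norm v + 0 * l2norm v"
      by (rule tendsto_lowerbound) (auto intro!: always_eventually est)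
    then show ?thesis by simp
  qed
  with pL sV lim show ?thesis by blast
qed

section \<open>Primitives on the half-line\<close>

lemma space_Rp[simp]: "space Rp = {0<..}"
  by (simp add: Rp_def)

lemma measurable_Rp_borel:
  "f \<in> measurable borel N \<Longrightarrow> f \<in> measurable Rp N"
  unfolding Rp_def by (intro measurable_restrict_space1 measurable_completion) simp

lemma measurable_ident_Rp[measurable]: "(\<lambda>x. x) \<in> borel_measurable Rp"
  by (rule measurable_Rp_borel) simp

lemma AE_Rp_iff: "(AE x in Rp. P x) \<longleftrightarrow> (AE x in lebesgue. x > 0 \<longrightarrow> P x)"
  unfolding Rp_def by (subst AE_restrict_space_iff) auto

lemma AE_lebesgue_neq: "AE x in lebesgue. x \<noteq> (a::real)"
  by (rule AE_completion) (rule AE_lborel_singleton)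

lemma AE_Rp_neq: "AE x in Rp. x \<noteq> a"
  unfolding AE_Rp_iff using AE_lebesgue_neq[of a] by (auto elim: eventually_mono)

lemma emeasure_Rp_finite: "emeasure Rp {0<..x} < \<infinity>"
proof -
  have "emeasure Rp {0<..x} = emeasure lborel {0<..x}"
    unfolding Rp_def by (subst emeasure_restrict_space) auto
  then show ?thesis by (cases "0 \<le> x") auto
qed

lemma Ioc_sets_Rp[measurable]: "{0<..x} \<in> sets Rp"
  by (auto simp: Rp_def sets_restrict_space_iff)

interpretation Rp: sigma_finite_measure Rp
proof
  show "\<exists>A. countable A \<and> A \<subseteq> sets Rp \<and> \<Union>A = space Rp \<and> (\<forall>a\<in>A. emeasure Rp a \<noteq> \<infinity>)"
  proof (intro exI[of _ "range (\<lambda>n::nat. {0<..real n})"] conjI ballI)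
    show "range (\<lambda>n::nat. {0<..real n}) \<subseteq> sets Rp"
      by (auto simp: Rp_def sets_restrict_space_iff)
    show "\<Union> (range (\<lambda>n::nat. {0<..real n})) = space Rp"
      by (auto intro: real_arch_simple)
    show "emeasure Rp a \<noteq> \<infinity>" if "a \<in> range (\<lambda>n::nat. {0<..real n})" for a
      using that emeasure_Rp_finite by (auto simp: less_top)
  qed auto
qed

interpretation Rp_pair: pair_sigma_finite Rp Rp ..

section \<open>Locally integrable functions, their primitives and the product rule\<close>

text \<open>Truncation by zero keeps every primitive an integral over the one measure
  \<open>Rp\<close>, so Fubini and dominated convergence apply with \<open>x\<close> as a mere
  parameter.\<close>

definition cutoff :: "(real \<Rightarrow> complex) \<Rightarrow> real \<Rightarrow> real \<Rightarrow> complex" where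
  "cutoff g x t = (if t \<le> x then g t else 0)"

definition prim :: "(real \<Rightarrow> complex) \<Rightarrow> real \<Rightarrow> complex" where
  "prim g x = (\<integral>t. cutoff g x t \<partial>Rp)"

text \<open>Square integrability is too narrow for the calculus: variation of constants multiplies
  by \<open>exp t\<close>. Local integrability up to 0 survives this and still provides
  primitives.\<close>

definition locint :: "(real \<Rightarrow> complex) \<Rightarrow> bool" where
  "locint g \<longleftrightarrow> g \<in> borel_measurable Rp \<and> (\<forall>x. integrable Rp (cutoff g x))"

lemma locintD: "locint g \<Longrightarrow> integrable Rp (cutoff g x)"
  by (simp add: locint_def)

lemma locint_measurable[measurable_dest]: "locint g \<Longrightarrow> g \<in> borel_measurable Rp"
  by (simp add: locint_def)

lemma cutoff_measurable[measurable]: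
  assumes [measurable]: "g \<in> borel_measurable Rp"
  shows "cutoff g x \<in> borel_measurable Rp"
  unfolding cutoff_def[abs_def] by measurable

lemma integrable_imp_locint: "integrable Rp g \<Longrightarrow> locint g"
  unfolding locint_def
proof (intro conjI allI)
  assume g: "integrable Rp g"
  then show "g \<in> borel_measurable Rp" by simp
  then show "integrable Rp (cutoff g x)" for x
    by (intro Bochner_Integration.integrable_bound[OF g]) (auto simp: cutoff_def)
qed

lemma locint_bound:
  assumes h: "locint h" and g: "g \<in> borel_measurable Rp"
    and le: "\<And>t x. 0 < t \<Longrightarrow> t \<le> x \<Longrightarrow> cmod (g t) \<le> C x * cmod (h t)"
  shows "locint g"
  unfolding locint_def
proof (intro conjI allI g)
  fix x
  have "integrable Rp (\<lambda>t. complex_of_real (C x) * cutoff h x t)"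
    by (intro integrable_mult_right locintD h)
  then show "integrable Rp (cutoff g x)"
  proof (rule Bochner_Integration.integrable_bound)
    show "cutoff g x \<in> borel_measurable Rp" using g by simp
    show "AE t in Rp. norm (cutoff g x t) \<le> norm (complex_of_real (C x) * cutoff h x t)"
    proof (rule AE_I2)
      fix t assume "t \<in> space Rp"
      then have "t \<le> x \<Longrightarrow> cmod (g t) \<le> \<bar>C x\<bar> * cmod (h t)"
        using le[of t x] by (simp add: order_trans[OF _ mult_right_mono[OF abs_ge_self]])
      then show "norm (cutoff g x t) \<le> norm (complex_of_real (C x) * cutoff h x t)"
        by (simp add: cutoff_def norm_mult)
    qed
  qed
qed

lemma locint_const: "locint (\<lambda>t. c)"
  unfolding locint_def
proof (intro conjI allI)
  fix x
  have "integrable Rp (\<lambda>t. indicator {0<..x} t *\<^sub>R c)"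
    using emeasure_Rp_finite[of x]
    by (intro integrable_scaleR_left integrable_real_indicator) auto
  then show "integrable Rp (cutoff (\<lambda>t. c) x)"
    by (rule Bochner_Integration.integrable_cong[THEN iffD1, rotated 2]) (auto simp: cutoff_def)
qed auto

lemma sqint_locint:
  assumes "g \<in> sqint" shows "locint g"
  unfolding locint_def
proof (intro conjI allI)
  show "g \<in> borel_measurable Rp" using assms by measurable
  fix x
  \<comment> \<open>On the half-line this is the indicator of \<open>(0,x]\<close>; its product with
    \<open>g\<close> is integrable as a product of two square integrable functions.\<close>
  have "cutoff (\<lambda>t. 1) x \<in> sqint"
    by (rule sqint_bound[of _ "\<lambda>t. cmod (cutoff (\<lambda>t. 1) x t)"])
      (auto simp: cutoff_def[abs_def] intro!: integrable_norm locintD[OF locint_const, unfolded cutoff_def[abs_def]])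
  from sqint_mult_integrable[OF this assms] show "integrable Rp (cutoff g x)"
    by (rule Bochner_Integration.integrable_cong[THEN iffD1, rotated 2]) (auto simp: cutoff_def)
qed

lemma locint_add: "locint g \<Longrightarrow> locint h \<Longrightarrow> locint (\<lambda>t. g t + h t)"
proof -
  assume g: "locint g" and h: "locint h"
  have eq: "cutoff (\<lambda>t. g t + h t) x = (\<lambda>t. cutoff g x t + cutoff h x t)" for x
    by (auto simp: cutoff_def)
  show ?thesis
    using g h unfolding locint_def eq by auto
qed

lemma locint_cmult: "locint g \<Longrightarrow> locint (\<lambda>t. c * g t)"
proof -
  assume g: "locint g"
  have eq: "cutoff (\<lambda>t. c * g t) x = (\<lambda>t. c * cutoff g x t)" for x
    by (auto simp: cutoff_def)
  show ?thesis
    using g unfolding locint_def eq by auto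
qed

lemma prim_add: "locint g \<Longrightarrow> locint h \<Longrightarrow> prim (\<lambda>t. g t + h t) x = prim g x + prim h x"
proof -
  assume g: "locint g" and h: "locint h"
  have eq: "cutoff (\<lambda>t. g t + h t) x = (\<lambda>t. cutoff g x t + cutoff h x t)" for x
    by (auto simp: cutoff_def)
  show ?thesis
    unfolding prim_def eq by (intro Bochner_Integration.integral_add locintD g h)
qed

lemma prim_cmult: "prim (\<lambda>t. c * g t) x = c * prim g x"
proof -
  have eq: "cutoff (\<lambda>t. c * g t) x = (\<lambda>t. c * cutoff g x t)" for x
    by (auto simp: cutoff_def)
  show ?thesis unfolding prim_def eq by simp
qed

lemma prim_cnj: "prim (\<lambda>t. cnj (g t)) x = cnj (prim g x)"
proof -
  have eq: "cutoff (\<lambda>t. cnj (g t)) x = (\<lambda>t. cnj (cutoff g x t))" for x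
    by (auto simp: cutoff_def)
  show ?thesis unfolding prim_def eq by simp
qed

lemma prim_cong: "(\<And>t. 0 < t \<Longrightarrow> g t = h t) \<Longrightarrow> prim g x = prim h x"
  unfolding prim_def by (rule Bochner_Integration.integral_cong) (auto simp: cutoff_def)

lemma prim_cong_AE:
  assumes "AE t in Rp. g t = h t" "g \<in> borel_measurable Rp" "h \<in> borel_measurable Rp"
  shows "prim g x = prim h x"
  unfolding prim_def
proof (rule integral_cong_AE)
  show "AE t in Rp. cutoff g x t = cutoff h x t"
    using assms(1) by eventually_elim (simp add: cutoff_def)
qed (use assms in measurable)

lemma prim_measurable_borel:
  assumes [measurable]: "g \<in> borel_measurable Rp" shows "prim g \<in> borel_measurable borel"
  unfolding prim_def[abs_def] cutoff_def by measurable

lemma prim_measurable[measurable]: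
  "g \<in> borel_measurable Rp \<Longrightarrow> prim g \<in> borel_measurable Rp"
  by (rule measurable_Rp_borel[OF prim_measurable_borel])

lemma norm_prim_le:
  assumes "locint g" "t \<le> x"
  shows "cmod (prim g t) \<le> (\<integral>s. cmod (cutoff g x s) \<partial>Rp)"
proof -
  have "cmod (prim g t) \<le> (\<integral>s. cmod (cutoff g t s) \<partial>Rp)"
    unfolding prim_def by (rule integral_norm_bound)
  also have "\<dots> \<le> (\<integral>s. cmod (cutoff g x s) \<partial>Rp)"
    using assms by (intro integral_mono integrable_norm locintD) (auto simp: cutoff_def)
  finally show ?thesis .
qed

lemma locint_mult_prim:
  assumes g: "locint g" and h: "locint h"
  shows "locint (\<lambda>t. g t * prim h t)"
proof (rule locint_bound[OF g])
  show "(\<lambda>t. g t * prim h t) \<in> borel_measurable Rp"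
    using g h by measurable
  fix t x :: real assume "t \<le> x"
  then have "cmod (g t) * cmod (prim h t) \<le> cmod (g t) * (\<integral>s. cmod (cutoff h x s) \<partial>Rp)"
    by (intro mult_left_mono norm_prim_le h) auto
  then show "cmod (g t * prim h t) \<le> (\<integral>s. cmod (cutoff h x s) \<partial>Rp) * cmod (g t)"
    by (simp add: norm_mult mult.commute)
qed

text \<open>Fubini on the square \<open>(0,x]\<^sup>2\<close>, split along the diagonal.\<close>

lemma prim_mult:
  assumes g: "locint g" and h: "locint h"
  shows "prim g x * prim h x = prim (\<lambda>t. g t * prim h t + prim g t * h t) x"
proof -
  note [measurable] = locint_measurable[OF g] locint_measurable[OF h]
  define F where "F s t = cutoff g x s * cutoff h x t" for s t
  define F1 where "F1 s t = (if t \<le> s then F s t else 0)" for s t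
  define F2 where "F2 s t = (if t \<le> s then 0 else F s t)" for s t
  have mF: "case_prod F \<in> borel_measurable (Rp \<Otimes>\<^sub>M Rp)"
    unfolding F_def cutoff_def by measurable
  have mF1: "case_prod F1 \<in> borel_measurable (Rp \<Otimes>\<^sub>M Rp)"
    unfolding F1_def F_def cutoff_def by measurable
  have mF2: "case_prod F2 \<in> borel_measurable (Rp \<Otimes>\<^sub>M Rp)"
    unfolding F2_def F_def cutoff_def by measurable
  have intF: "integrable (Rp \<Otimes>\<^sub>M Rp) (case_prod F)"
  proof (rule Rp_pair.Fubini_integrable[OF mF])
    show "integrable Rp (\<lambda>s. \<integral>t. norm (case_prod F (s, t)) \<partial>Rp)"
      by (simp add: F_def norm_mult integrable_norm locintD g)
    show "AE s in Rp. integrable Rp (\<lambda>t. case_prod F (s, t))"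
      by (simp add: F_def locintD h)
  qed
  have intF1: "integrable (Rp \<Otimes>\<^sub>M Rp) (case_prod F1)"
    by (rule Bochner_Integration.integrable_bound[OF intF mF1]) (auto simp: F1_def)
  have intF2: "integrable (Rp \<Otimes>\<^sub>M Rp) (case_prod F2)"
    by (rule Bochner_Integration.integrable_bound[OF intF mF2]) (auto simp: F2_def)
  have "prim g x * prim h x = (\<integral>s. (\<integral>t. F s t \<partial>Rp) \<partial>Rp)"
    by (simp add: F_def prim_def)
  also have "\<dots> = integral\<^sup>L (Rp \<Otimes>\<^sub>M Rp) (case_prod F)"
    by (rule Rp_pair.integral_fst[OF intF])
  also have "case_prod F = (\<lambda>z. case_prod F1 z + case_prod F2 z)"
    by (auto simp: F1_def F2_def)
  also have "integral\<^sup>L (Rp \<Otimes>\<^sub>M Rp) \<dots> =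
      integral\<^sup>L (Rp \<Otimes>\<^sub>M Rp) (case_prod F1) + integral\<^sup>L (Rp \<Otimes>\<^sub>M Rp) (case_prod F2)"
    by (rule Bochner_Integration.integral_add[OF intF1 intF2])
  also have "integral\<^sup>L (Rp \<Otimes>\<^sub>M Rp) (case_prod F1) = (\<integral>s. (\<integral>t. F1 s t \<partial>Rp) \<partial>Rp)"
    by (rule Rp_pair.integral_fst[OF intF1, symmetric])
  also have "\<dots> = prim (\<lambda>t. g t * prim h t) x"
  proof -
    have "F1 s = (\<lambda>t. cutoff g x s * cutoff h s t)" for s
      by (auto simp: F1_def F_def cutoff_def)
    then have "(\<integral>t. F1 s t \<partial>Rp) = cutoff (\<lambda>t. g t * prim h t) x s" for s
      by (simp add: prim_def cutoff_def)
    then show ?thesis by (simp add: prim_def)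
  qed
  also have "integral\<^sup>L (Rp \<Otimes>\<^sub>M Rp) (case_prod F2) = (\<integral>t. (\<integral>s. F2 s t \<partial>Rp) \<partial>Rp)"
    by (rule Rp_pair.integral_snd[OF intF2, symmetric])
  also have "\<dots> = prim (\<lambda>t. prim g t * h t) x"
  proof -
    have "(\<integral>s. F2 s t \<partial>Rp) = (\<integral>s. cutoff h x t * cutoff g t s \<partial>Rp)" for t
    proof (rule integral_cong_AE)
      show "(\<lambda>s. F2 s t) \<in> borel_measurable Rp"
        unfolding F2_def F_def by measurable
      \<comment> \<open>\<open>F2\<close> lives on \<open>s < t\<close>, the truncated
        \<open>g\<close> on \<open>s \<le> t\<close>: they differ at most at the single point
        \<open>s = t\<close>.\<close>
      show "AE s in Rp. F2 s t = cutoff h x t * cutoff g t s"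
        using AE_Rp_neq[of t] by eventually_elim (auto simp: F2_def F_def cutoff_def)
    qed measurable
    then have "(\<integral>s. F2 s t \<partial>Rp) = cutoff (\<lambda>t. prim g t * h t) x t" for t
      by (simp add: prim_def cutoff_def)
    then show ?thesis by (simp add: prim_def)
  qed
  also have "prim (\<lambda>t. g t * prim h t) x + prim (\<lambda>t. prim g t * h t) x
      = prim (\<lambda>t. g t * prim h t + prim g t * h t) x"
    using locint_mult_prim[OF g h] locint_mult_prim[OF h g]
    by (intro prim_add[symmetric]) (auto simp: mult.commute)
  finally show ?thesis .
qed

lemma prim_mult_affine:
  assumes g: "locint g" and h: "locint h"
  shows "(a + prim g x) * (b + prim h x) = a * b + prim (\<lambda>t. g t * (b + prim h t) + (a + prim g t) * h t) x"
    and "locint (\<lambda>t. g t * (b + prim h t) + (a + prim g t) * h t)"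
proof -
  have l1: "locint (\<lambda>t. g t * prim h t + prim g t * h t)"
    using locint_add[OF locint_mult_prim[OF g h] locint_mult_prim[OF h g]] by (simp add: mult.commute)
  have l2: "locint (\<lambda>t. b * g t + a * h t)"
    by (intro locint_add locint_cmult g h)
  have eq: "(\<lambda>t. g t * (b + prim h t) + (a + prim g t) * h t)
    = (\<lambda>t. (g t * prim h t + prim g t * h t) + (b * g t + a * h t))"
    by (auto simp: algebra_simps)
  show "locint (\<lambda>t. g t * (b + prim h t) + (a + prim g t) * h t)"
    unfolding eq by (rule locint_add[OF l1 l2])
  show "(a + prim g x) * (b + prim h x) = a * b + prim (\<lambda>t. g t * (b + prim h t) + (a + prim g t) * h t) x"
    unfolding eq prim_add[OF l1 l2] prim_mult[OF g h, symmetric]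
    by (simp add: prim_add locint_cmult g h prim_cmult algebra_simps)
qed

section \<open>Sobolev functions on the half-line: integration by parts and uniqueness of the
  derivative\<close>

lemma prim_eq_lebesgue_on:
  assumes g: "g \<in> borel_measurable Rp"
  shows "integrable (lebesgue_on {0..x}) g \<longleftrightarrow> integrable Rp (cutoff g x)"
    and "(\<integral>t. g t \<partial>(lebesgue_on {0..x})) = prim g x"
proof -
  have "cutoff g x \<in> borel_measurable (lebesgue_on {0<..})"
    using g unfolding Rp_def[symmetric] by measurable
  then have m1: "(\<lambda>t. indicator {0<..} t *\<^sub>R cutoff g x t) \<in> borel_measurable lebesgue"
    by (subst borel_measurable_restrict_space_iff[symmetric]) auto
  have ae: "AE t in lebesgue. indicator {0<..} t *\<^sub>R cutoff g x t = indicator {0..x} t *\<^sub>R g t"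
    using AE_lebesgue_neq[of 0] by eventually_elim (auto simp: cutoff_def indicator_def)
  \<comment> \<open>\<open>Rp\<close> does not control the value of \<open>g\<close> at 0;
    completeness of Lebesgue measure still yields measurability on the closed interval.\<close>
  have m2: "(\<lambda>t. indicator {0..x} t *\<^sub>R g t) \<in> borel_measurable lebesgue"
    by (rule borel_measurable_AE[OF m1 ae])
  show "integrable (lebesgue_on {0..x}) g \<longleftrightarrow> integrable Rp (cutoff g x)"
    unfolding Rp_def using integrable_cong_AE[OF m1 m2 ae]
    by (simp add: integrable_restrict_space)
  show "(\<integral>t. g t \<partial>(lebesgue_on {0..x})) = prim g x"
    unfolding Rp_def prim_def using integral_cong_AE[OF m1 m2 ae]
    by (simp add: integral_restrict_space)
qed

lemma sob1_iff:
  "sob1 u c du \<longleftrightarrow> u \<in> sqint \<and> du \<in> sqint \<and> (AE x in Rp. u x = c + prim du x)"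
proof -
  have "integrable (lebesgue_on {0..x}) du" if "du \<in> sqint" for x
    using sqint_locint[OF that] prim_eq_lebesgue_on(1)[of du x] sqint_measurable[OF that]
    by (simp add: locint_def)
  then show ?thesis
    unfolding sob1_def using prim_eq_lebesgue_on(2)[of du] sqint_measurable[of du] by auto
qed

lemma prim_tendsto_at_top:
  assumes g: "integrable Rp g"
  shows "(prim g \<longlongrightarrow> (\<integral>t. g t \<partial>Rp)) at_top"
  unfolding prim_def[abs_def]
proof (rule integral_dominated_convergence_at_top)
  show "integrable Rp (\<lambda>t. cmod (g t))" using g by simp
  show "AE t in Rp. ((\<lambda>x. cutoff g x t) \<longlongrightarrow> g t) at_top"
  proof (rule AE_I2)
    fix t
    have "\<forall>\<^sub>F x in at_top. cutoff g x t = g t"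
      using eventually_ge_at_top[of t] by eventually_elim (simp add: cutoff_def)
    then show "((\<lambda>x. cutoff g x t) \<longlongrightarrow> g t) at_top"
      by (simp add: tendsto_eventually)
  qed
qed (use g in \<open>auto simp: cutoff_def\<close>)

lemma continuous_prim:
  assumes g: "locint g" shows "continuous (at x) (prim g)"
  unfolding continuous_at_sequentially comp_def
proof (intro allI impI)
  note [measurable] = locint_measurable[OF g]
  fix X :: "nat \<Rightarrow> real" assume X: "X \<longlonglongrightarrow> x"
  obtain M where M: "\<And>n. X n \<le> M"
    using Bseq_bdd_above[OF convergent_imp_Bseq[OF convergentI[OF X]]]
    by (auto simp: bdd_above_def)
  show "(\<lambda>n. prim g (X n)) \<longlonglongrightarrow> prim g x"
    unfolding prim_def
  proof (rule integral_dominated_convergence)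
    show "integrable Rp (\<lambda>t. cmod (cutoff g M t))"
      by (intro integrable_norm locintD g)
    show "AE t in Rp. (\<lambda>n. cutoff g (X n) t) \<longlonglongrightarrow> cutoff g x t"
      using AE_Rp_neq[of x]
    proof eventually_elim
      case (elim t)
      then consider "t < x" | "x < t" by linarith
      then have "\<forall>\<^sub>F n in sequentially. cutoff g (X n) t = cutoff g x t"
      proof cases
        case 1
        from order_tendstoD(1)[OF X 1] show ?thesis
          by eventually_elim (use 1 in \<open>auto simp: cutoff_def\<close>)
      next
        case 2
        from order_tendstoD(2)[OF X 2] show ?thesis
          by eventually_elim (use 2 in \<open>auto simp: cutoff_def\<close>)
      qed
      then show ?case by (simp add: tendsto_eventually)
    qed
    show "AE t in Rp. norm (cutoff g (X n) t) \<le> cmod (cutoff g M t)" for n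
      using M[of n] by (auto simp: cutoff_def)
  qed measurable
qed

lemma emeasure_Rp_tail: "emeasure Rp {X<..} = \<infinity>" if "X \<ge> 0"
proof -
  have "emeasure Rp {X<..} = emeasure lebesgue {X<..}"
    unfolding Rp_def using that by (subst emeasure_restrict_space) auto
  also have "\<dots> = \<infinity>"
  proof (rule ccontr)
    assume "emeasure lebesgue {X<..} \<noteq> \<infinity>"
    then obtain r where r: "emeasure lebesgue {X<..} = ennreal r" "r \<ge> 0"
      by (cases "emeasure lebesgue {X<..}") auto
    have "ennreal (r + 1) = emeasure lebesgue {X<..X + (r + 1)}" using r(2) by simp
    also have "\<dots> \<le> emeasure lebesgue {X<..}" by (intro emeasure_mono) auto
    finally show False using r by (simp add: ennreal_le_iff)
  qed
  finally show ?thesis .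
qed

lemma integrable_tendsto_imp_zero:
  fixes F :: "real \<Rightarrow> complex"
  assumes int: "integrable Rp F" and lim: "(F \<longlongrightarrow> L) at_top"
  shows "L = 0"
proof (rule ccontr)
  assume "L \<noteq> 0"
  define c where "c = cmod L / 2"
  have c: "c > 0" using \<open>L \<noteq> 0\<close> by (simp add: c_def)
  have "((\<lambda>x. cmod (F x)) \<longlongrightarrow> cmod L) at_top" by (intro tendsto_norm lim)
  then have "\<forall>\<^sub>F x in at_top. c < cmod (F x)"
    by (rule order_tendstoD) (use \<open>L \<noteq> 0\<close> in \<open>simp add: c_def\<close>)
  then obtain X where X: "\<And>x. x \<ge> X \<Longrightarrow> c < cmod (F x)"
    by (auto simp: eventually_at_top_linorder)
  define Y where "Y = max X 0"
  have S: "{Y<..} \<in> sets Rp" by (auto simp: Rp_def sets_restrict_space_iff Y_def)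
  have "integrable Rp (\<lambda>x. c * indicat_real {Y<..} x)"
  proof (rule Bochner_Integration.integrable_bound[OF integrable_norm[OF int]])
    show "AE x in Rp. norm (c * indicat_real {Y<..} x) \<le> norm (cmod (F x))"
      using X c by (auto simp: indicator_def Y_def less_imp_le intro!: AE_I2)
  qed (use S in measurable)
  then have "integrable Rp (indicat_real {Y<..})"
    using c by simp
  then have "emeasure Rp ({Y<..} \<inter> space Rp) < \<infinity>"
    by (simp add: integrable_indicator_iff)
  moreover have "{Y<..} \<inter> space Rp = {Y<..}" by (auto simp: Y_def)
  ultimately show False
    using emeasure_Rp_tail[of Y] by (simp add: Y_def)
qed

text \<open>By the product rule the product of the continuous representatives is
  \<open>a * b\<close> plus the primitive of an integrable function, so it has a limit at infinity.
  The product is itself integrable, so this limit is 0, and only the boundary term at 0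
  remains.\<close>

lemma sob1_integral_by_parts:
  assumes u: "sob1 u a du" and w: "sob1 w b dw"
  shows "(\<integral>x. du x * w x + u x * dw x \<partial>Rp) = - (a * b)"
    and "((\<lambda>x. (a + prim du x) * (b + prim dw x)) \<longlongrightarrow> 0) at_top"
proof -
  have uq: "u \<in> sqint" "du \<in> sqint" "w \<in> sqint" "dw \<in> sqint" and
    ae: "AE x in Rp. u x = a + prim du x" "AE x in Rp. w x = b + prim dw x"
    using u w by (auto simp: sob1_iff)
  note [measurable] = uq[THEN sqint_measurable]
  define I where "I t = du t * (b + prim dw t) + (a + prim du t) * dw t" for t
  have int0: "integrable Rp (\<lambda>x. du x * w x + u x * dw x)"
    by (intro Bochner_Integration.integrable_add sqint_mult_integrable uq)
  have mI[measurable]: "I \<in> borel_measurable Rp" unfolding I_def[abs_def] by measurable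
  have aeI: "AE x in Rp. du x * w x + u x * dw x = I x"
    using ae by eventually_elim (simp add: I_def)
  have intI: "integrable Rp I"
    using aeI by (intro integrable_cong_AE_imp[OF int0]) auto
  have eq: "(a + prim du x) * (b + prim dw x) = a * b + prim I x" for x
    unfolding I_def by (intro prim_mult_affine sqint_locint uq)
  have lim: "((\<lambda>x. (a + prim du x) * (b + prim dw x)) \<longlongrightarrow> a * b + (\<integral>x. I x \<partial>Rp)) at_top"
    unfolding eq by (intro tendsto_intros prim_tendsto_at_top intI)
  have "AE x in Rp. u x * w x = (a + prim du x) * (b + prim dw x)"
    using ae by eventually_elim simp
  then have "integrable Rp (\<lambda>x. (a + prim du x) * (b + prim dw x))"
    by (intro integrable_cong_AE_imp[OF sqint_mult_integrable[OF uq(1,3)]]) auto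
  from integrable_tendsto_imp_zero[OF this lim] have z: "a * b + (\<integral>x. I x \<partial>Rp) = 0" .
  show "((\<lambda>x. (a + prim du x) * (b + prim dw x)) \<longlongrightarrow> 0) at_top"
    using lim unfolding z .
  have "(\<integral>x. du x * w x + u x * dw x \<partial>Rp) = (\<integral>x. I x \<partial>Rp)"
    using aeI by (intro integral_cong_AE) auto
  with z show "(\<integral>x. du x * w x + u x * dw x \<partial>Rp) = - (a * b)"
    by (simp add: add_eq_0_iff)
qed

lemma sob1_cnj: "sob1 u c du \<Longrightarrow> sob1 (\<lambda>x. cnj (u x)) (cnj c) (\<lambda>x. cnj (du x))"
  unfolding sob1_iff by (auto simp: sqint_cnj prim_cnj)

text \<open>Taking the conjugate of \<open>u\<close> as the second factor of the integration by
  parts makes the product \<open>|u|^2\<close>.\<close>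

lemma sob1_tendsto_zero:
  assumes u: "sob1 u a du" shows "((\<lambda>x. a + prim du x) \<longlongrightarrow> 0) at_top"
proof -
  have "((\<lambda>x. (a + prim du x) * (cnj a + prim (\<lambda>x. cnj (du x)) x)) \<longlongrightarrow> 0) at_top"
    by (rule sob1_integral_by_parts(2)[OF u sob1_cnj[OF u]])
  then have "((\<lambda>x. complex_of_real ((cmod (a + prim du x))\<^sup>2)) \<longlongrightarrow> 0) at_top"
    unfolding complex_norm_square by (simp add: prim_cnj)
  then have "((\<lambda>x. (cmod (a + prim du x))\<^sup>2) \<longlongrightarrow> 0) at_top"
    by (simp add: tendsto_of_real_iff[of _ 0, simplified] del: of_real_power)
  then have "((\<lambda>x. sqrt ((cmod (a + prim du x))\<^sup>2)) \<longlongrightarrow> sqrt 0) at_top"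
    by (intro tendsto_intros)
  then show ?thesis
    by (simp add: tendsto_norm_zero_iff)
qed

text \<open>Lebesgue differentiation: almost every value of \<open>g\<close> is the limit of its
  means over \<open>[x, x + h]\<close>, and all these means vanish. This makes weak derivatives
  unique and hence \<open>Bgraph\<close> single-valued.\<close>

lemma prim_eq_0_imp:
  assumes g: "locint g" and z: "\<And>x. 0 < x \<Longrightarrow> prim g x = 0"
  shows "AE t in Rp. g t = 0"
proof -
  define f where "f t = indicator {0<..} t *\<^sub>R g t" for t
  have prim0: "prim g x = 0" for x
  proof (cases "0 < x")
    case False
    then have "prim g x = (\<integral>t. 0 \<partial>Rp)"
      unfolding prim_def by (intro Bochner_Integration.integral_cong) (auto simp: cutoff_def)
    then show ?thesis by simp
  qed (rule z)
  have hi: "((\<lambda>t. f t) has_integral 0) {a..b}" if "a \<le> b" for a b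
  proof -
    define k where "k t = cutoff g b t - cutoff g a t" for t
    have intk: "integrable Rp k" unfolding k_def by (intro Bochner_Integration.integrable_diff locintD g)
    have "integral\<^sup>L Rp k = prim g b - prim g a"
      unfolding k_def prim_def by (intro Bochner_Integration.integral_diff locintD g)
    then have "integral\<^sup>L lebesgue (\<lambda>t. indicator {0<..} t *\<^sub>R k t) = 0"
      unfolding Rp_def by (simp add: integral_restrict_space prim0)
    moreover have "integrable lebesgue (\<lambda>t. indicator {0<..} t *\<^sub>R k t)"
      using intk unfolding Rp_def by (simp add: integrable_restrict_space)
    ultimately have "((\<lambda>t. indicator {0<..} t *\<^sub>R k t) has_integral 0) UNIV"
      using has_integral_integral_lebesgue[of "\<lambda>t. indicator {0<..} t *\<^sub>R k t"] by simp
    \<comment> \<open>On the half-line \<open>k\<close> is \<open>g\<close> restricted to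
      \<open>(a,b]\<close>, so passing to the closed interval changes the function at
      \<open>a\<close> only.\<close>
    then have "((\<lambda>t. if t \<in> {a..b} then f t else 0) has_integral 0) UNIV"
      by (rule has_integral_spike[of "{a}", rotated 2])
        (use that in \<open>auto simp: f_def k_def cutoff_def\<close>)
    then show ?thesis by (simp only: has_integral_restrict_UNIV)
  qed
  have int0: "f integrable_on cbox a b" "integral (cbox a b) f = 0" for a b
    using hi[of a b] by (cases "a \<le> b"; auto simp: integral_unique has_integral_integrable)+
  obtain N where N: "negligible N"
    "\<And>x e. \<lbrakk>x \<notin> N; 0 < e\<rbrakk> \<Longrightarrow> \<exists>d>0. \<forall>h. 0 < h \<and> h < d \<longrightarrow>
        norm (integral (cbox x (x + h *\<^sub>R One)) f /\<^sub>R h ^ DIM(real) - f x) < e"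
    using integrable_ccontinuous_explicit[OF int0(1)] by metis
  have "f x = 0" if xN: "x \<notin> N" for x
  proof (rule ccontr)
    assume "f x \<noteq> 0"
    then obtain d where d: "d > 0" "\<forall>h. 0 < h \<and> h < d \<longrightarrow>
        norm (integral (cbox x (x + h *\<^sub>R One)) f /\<^sub>R h ^ DIM(real) - f x) < cmod (f x)"
      using N(2)[OF xN, of "cmod (f x)"] by auto
    have "norm (integral (cbox x (x + (d/2) *\<^sub>R One)) f /\<^sub>R (d/2) ^ DIM(real) - f x) < cmod (f x)"
      by (rule d(2)[rule_format]) (use d(1) in auto)
    then show False unfolding int0(2) by simp
  qed
  then have "AE x in lebesgue. f x = 0"
    using N(1) unfolding eventually_ae_filter_negligible by blast
  then show ?thesis
    unfolding AE_Rp_iff by eventually_elim (simp add: f_def split: split_indicator_asm)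
qed

lemma AE_Rp_imp_continuous_eq_0:
  assumes cont: "\<And>x. 0 < x \<Longrightarrow> continuous (at x) F" and ae: "AE x in Rp. F x = (0::complex)" and x: "0 < x"
  shows "F x = 0"
proof (rule ccontr)
  assume "F x \<noteq> 0"
  from cont[OF x, THEN continuous_at_avoid, OF this]
  obtain e where e: "e > 0" "\<And>y. dist x y < e \<Longrightarrow> F y \<noteq> 0" by blast
  have "AE y in lebesgue. y > 0 \<longrightarrow> F y = 0" using ae by (simp add: AE_Rp_iff)
  then obtain N where N: "negligible N" "{y. \<not> (y > 0 \<longrightarrow> F y = 0)} \<subseteq> N"
    unfolding eventually_ae_filter_negligible by auto
  have "{x<..<x + e} \<subseteq> N"
    using N(2) e x by (force simp: dist_real_def)
  then have "negligible {x<..<x + e}" using N(1) negligible_subset by blast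
  then show False using e(1) open_not_negligible[of "{x<..<x+e}"] by auto
qed

lemma sob1_zero_imp:
  assumes "sob1 u 0 du" "AE x in Rp. u x = 0"
  shows "AE x in Rp. du x = 0"
proof (rule prim_eq_0_imp)
  show l: "locint du" using assms by (auto simp: sob1_iff intro: sqint_locint)
  have "AE x in Rp. u x = 0 + prim du x" using assms by (auto simp: sob1_iff)
  with assms(2) have "AE x in Rp. prim du x = 0" by eventually_elim simp
  then show "prim du x = 0" if "0 < x" for x
    using that by (intro AE_Rp_imp_continuous_eq_0[of "prim du"] continuous_prim l)
qed

section \<open>The resolvent of differentiation\<close>

lemma prim_FTC:
  assumes x: "0 \<le> x" and g: "locint g" 
    and der: "\<And>t. (F has_vector_derivative g t) (at t)"
  shows "F x = F 0 + prim g x"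
proof -
  have m: "g \<in> borel_measurable Rp" using g by measurable
  have int: "integrable (lebesgue_on {0..x}) g"
    using prim_eq_lebesgue_on(1)[OF m] locintD[OF g] by simp
  have "(g has_integral (F x - F 0)) {0..x}"
    by (rule fundamental_theorem_of_calculus[OF x has_vector_derivative_at_within[OF der]])
  then have "(\<integral>t. g t \<partial>(lebesgue_on {0..x})) = F x - F 0"
    using lebesgue_integral_eq_integral[OF int] by (simp add: integral_unique)
  then show ?thesis unfolding prim_eq_lebesgue_on(2)[OF m] by simp
qed

lemma measurable_of_continuous: "continuous_on UNIV f \<Longrightarrow> f \<in> borel_measurable Rp"
  by (intro measurable_Rp_borel borel_measurable_continuous_onI)

lemma locint_exp: 
  assumes "0 < k" shows "locint (\<lambda>t. complex_of_real (exp (- k * t)))"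
proof (rule locint_bound[OF locint_const[of 1], of _ "\<lambda>_. 1"])
  show "(\<lambda>t. complex_of_real (exp (- k * t))) \<in> borel_measurable Rp"
    by (intro measurable_of_continuous continuous_intros)
qed (use assms in auto)

lemma exp_eq_prim:
  assumes k: "0 < k" and x: "0 \<le> x"
  shows "complex_of_real (exp (- k * x)) = 1 + prim (\<lambda>t. - k * complex_of_real (exp (- k * t))) x"
proof -
  have "((\<lambda>t. complex_of_real (exp (- k * t))) has_vector_derivative - k * complex_of_real (exp (- k * t))) (at t)" for t
  proof -
    have "((\<lambda>t. exp (- k * t)) has_real_derivative - k * exp (- k * t)) (at t)"
      by (auto intro!: derivative_eq_intros)
    from has_vector_derivative_of_real[OF this] show ?thesis by simp
  qed
  from prim_FTC[OF x locint_cmult[OF locint_exp[OF k]] this] show ?thesis by simp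
qed

lemma Re_prim_nonneg:
  assumes "locint g" "\<And>t. 0 \<le> Re (g t)" shows "0 \<le> Re (prim g x)"
proof -
  have "Re (prim g x) = (\<integral>t. Re (cutoff g x t) \<partial>Rp)"
    unfolding prim_def by (rule integral_Re[symmetric, OF locintD[OF assms(1)]])
  also have "\<dots> \<ge> 0"
    by (intro Bochner_Integration.integral_nonneg) (auto simp: cutoff_def assms(2))
  finally show ?thesis .
qed

text \<open>Truncation at \<open>x = n\<close> and Fatou turn a uniform bound on the primitive into
  integrability. The square is written \<open>g t * cnj (g t)\<close> and not as a norm, so that the
  complex product rule for \<open>prim\<close> applies to it.\<close>

lemma sqint_of_bounded_prim:
  assumes g[measurable]: "g \<in> borel_measurable Rp" and l: "locint (\<lambda>t. g t * cnj (g t))"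
    and le: "\<And>x. 0 \<le> x \<Longrightarrow> Re (prim (\<lambda>t. g t * cnj (g t)) x) \<le> C"
  shows "g \<in> sqint"
proof -
  let ?G = "\<lambda>t. g t * cnj (g t)"
  have cutG: "cmod (cutoff ?G x t) = Re (cutoff ?G x t)" for x t
    by (simp add: cutoff_def complex_mult_cnj del: of_real_add)
  have "(\<integral>\<^sup>+t. ennreal ((cmod (g t))\<^sup>2) \<partial>Rp) = (\<integral>\<^sup>+t. liminf (\<lambda>n. ennreal (cmod (cutoff ?G (real n) t))) \<partial>Rp)"
  proof (rule nn_integral_cong)
    fix t
    have "\<forall>\<^sub>F n in sequentially. t \<le> real n"
      using eventually_ge_at_top[of "nat \<lceil>t\<rceil>"] by eventually_elim linarith
    then have "\<forall>\<^sub>F n in sequentially. ennreal (cmod (cutoff ?G (real n) t)) = ennreal ((cmod (g t))\<^sup>2)"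
      by eventually_elim (simp add: cutoff_def norm_mult power2_eq_square)
    then have "(\<lambda>n. ennreal (cmod (cutoff ?G (real n) t))) \<longlonglongrightarrow> ennreal ((cmod (g t))\<^sup>2)"
      by (rule tendsto_eventually)
    then show "ennreal ((cmod (g t))\<^sup>2) = liminf (\<lambda>n. ennreal (cmod (cutoff ?G (real n) t)))"
      by (rule lim_imp_Liminf[OF sequentially_bot, symmetric])
  qed
  also have "\<dots> \<le> liminf (\<lambda>n. \<integral>\<^sup>+t. ennreal (cmod (cutoff ?G (real n) t)) \<partial>Rp)"
    by (intro nn_integral_liminf) measurable
  also have "\<dots> \<le> ennreal C"
  proof (rule Liminf_le)
    have "(\<integral>\<^sup>+t. ennreal (cmod (cutoff ?G (real n) t)) \<partial>Rp) \<le> ennreal C" for n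
    proof -
      have "(\<integral>\<^sup>+t. ennreal (cmod (cutoff ?G (real n) t)) \<partial>Rp) = ennreal (\<integral>t. cmod (cutoff ?G (real n) t) \<partial>Rp)"
        by (intro nn_integral_eq_integral integrable_norm locintD l) simp
      also have "(\<integral>t. cmod (cutoff ?G (real n) t) \<partial>Rp) = Re (prim ?G (real n))"
        unfolding cutG prim_def by (rule integral_Re[OF locintD[OF l]])
      finally show ?thesis using le[of "real n"] by (simp add: ennreal_leI)
    qed
    then show "\<forall>\<^sub>F n in sequentially. (\<integral>\<^sup>+t. ennreal (cmod (cutoff ?G (real n) t)) \<partial>Rp) \<le> ennreal C"
      by simp
  qed simp
  also have "\<dots> < \<infinity>" by simp
  finally have "integrable Rp (\<lambda>t. (cmod (g t))\<^sup>2)"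
    by (intro integrableI_bounded) auto
  with g show ?thesis by (simp add: sqint_def)
qed

lemma sqint_exp: 
  assumes k: "0 < k" shows "(\<lambda>t. complex_of_real (exp (- k * t))) \<in> sqint"
proof (rule sqint_of_bounded_prim)
  let ?e = "\<lambda>t. complex_of_real (exp (- k * t))"
  have eq: "?e t * cnj (?e t) = complex_of_real (exp (- (2 * k) * t))" for t
    by (simp flip: of_real_mult exp_add)
  show "?e \<in> borel_measurable Rp" by (rule locint_measurable[OF locint_exp[OF k]])
  show "locint (\<lambda>t. ?e t * cnj (?e t))" unfolding eq by (rule locint_exp) (use k in simp)
  fix x :: real assume x: "0 \<le> x"
  \<comment> \<open>The equation for the rate \<open>2 * k\<close> expresses the integral of the
    squared exponential through the value at \<open>x\<close>, whence the bound
    \<open>1 / (2 * k)\<close>.\<close>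
  have "complex_of_real (exp (- (2 * k) * x)) = 1 + - (2 * k) * prim (\<lambda>t. complex_of_real (exp (- (2 * k) * t))) x"
    using exp_eq_prim[of "2 * k" x] k x prim_cmult[of "- complex_of_real (2 * k)"] by simp
  then have "exp (- (2 * k) * x) = 1 - 2 * k * Re (prim (\<lambda>t. complex_of_real (exp (- (2 * k) * t))) x)"
    by (simp add: complex_eq_iff)
  then have "2 * k * Re (prim (\<lambda>t. complex_of_real (exp (- (2 * k) * t))) x) \<le> 1"
    using exp_ge_zero[of "- (2 * k) * x"] by linarith
  then show "Re (prim (\<lambda>t. ?e t * cnj (?e t)) x) \<le> 1 / (2 * k)"
    unfolding eq using k by (simp add: field_simps)
qed

lemma sob1_exp:
  assumes k: "0 < k"
  shows "sob1 (\<lambda>t. complex_of_real (exp (- k * t))) 1 (\<lambda>t. - k * complex_of_real (exp (- k * t)))"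
  unfolding sob1_iff using sqint_exp[OF k] sqint_cmult[OF sqint_exp[OF k], of "- k"] exp_eq_prim[OF k]
  by (auto intro!: AE_I2)

text \<open>The solution of \<open>u' + u = f\<close>, \<open>u(0) = 0\<close>. It is square integrable because of the energy identity
  \<open>|f|\<^sup>2 - |u|\<^sup>2 = |f - u|\<^sup>2 + (|u|\<^sup>2)'\<close>.\<close>

lemma resolvent_exists:
  assumes f: "f \<in> sqint"
  shows "\<exists>u. sob1 u 0 (\<lambda>x. f x - u x)"
proof -
  define E where "E t = complex_of_real (exp (- 1 * t))" for t
  define h where "h t = complex_of_real (exp t) * f t" for t
  \<comment> \<open>Variation of constants: \<open>exp (-t)\<close> times the primitive of
    \<open>exp s * f s\<close>. The function \<open>g\<close> below is the derivative of
    \<open>u\<close>.\<close>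
  define u where "u t = E t * prim h t" for t
  define g where "g t = f t - u t" for t
  have lf: "locint f" by (rule sqint_locint[OF f])
  have lE: "locint E" unfolding E_def by (rule locint_exp) simp
  have lh: "locint h"
  proof (rule locint_bound[OF lf, of _ exp])
    have "(\<lambda>t. complex_of_real (exp t)) \<in> borel_measurable Rp"
      by (intro measurable_of_continuous continuous_intros)
    then show "h \<in> borel_measurable Rp"
      unfolding h_def[abs_def] using sqint_measurable[OF f] by measurable
    show "cmod (h t) \<le> exp x * cmod (f t)" if "t \<le> x" for t x
      using that by (simp add: h_def norm_mult mult_right_mono)
  qed
  have lu: "locint u" unfolding u_def[abs_def] by (rule locint_mult_prim[OF lE lh])
  have lg: "locint g"
    using locint_add[OF lf locint_cmult[OF lu, of "-1"]] by (simp add: g_def[abs_def])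
  note [measurable] = lf[THEN locint_measurable] lE[THEN locint_measurable]
    lu[THEN locint_measurable] lg[THEN locint_measurable]
  have E1: "E x = 1 + prim (\<lambda>t. - E t) x" if "0 \<le> x" for x
    using exp_eq_prim[of 1 x] that by (simp add: E_def[abs_def])
  have Ef: "E t * h t = f t" for t
    by (simp add: E_def h_def exp_minus flip: mult.assoc)
  have ug: "u x = prim g x" if x: "0 \<le> x" for x
  proof -
    have l: "locint (\<lambda>t. - E t)" using locint_cmult[OF lE, of "-1"] by simp
    have "u x = (1 + prim (\<lambda>t. - E t) x) * (0 + prim h x)"
      unfolding u_def using E1[OF x] by simp
    also have "\<dots> = prim (\<lambda>t. - E t * (0 + prim h t) + (1 + prim (\<lambda>t. - E t) t) * h t) x"
      by (subst prim_mult_affine(1)[OF l lh]) simp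
    also have "\<dots> = prim g x"
    proof (rule prim_cong)
      fix t :: real assume "0 < t"
      then have "1 + prim (\<lambda>t. - E t) t = E t" using E1[of t] by simp
      then show "- E t * (0 + prim h t) + (1 + prim (\<lambda>t. - E t) t) * h t = g t"
        by (simp add: Ef g_def u_def)
    qed
    finally show ?thesis .
  qed
  have lff: "locint (\<lambda>t. f t * cnj (f t))"
    by (intro integrable_imp_locint sqint_mult_integrable sqint_cnj f)
  have luu: "locint (\<lambda>t. u t * cnj (u t))"
  proof -
    \<comment> \<open>Grouping \<open>E\<close> with \<open>cnj u\<close> leaves the primitive
      \<open>prim h\<close> as the other factor of \<open>|u|^2\<close>. So
      \<open>locint_mult_prim\<close> applies before \<open>u\<close> is known to be square
      integrable.\<close>
    have "locint (\<lambda>t. cnj (u t) * E t)"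
      by (rule locint_bound[OF lu, of _ "\<lambda>_. 1"]) (auto simp: E_def norm_mult mult_left_le)
    from locint_mult_prim[OF this lh] show ?thesis
      by (simp add: u_def mult_ac)
  qed
  have lcg: "locint (\<lambda>t. cnj (g t))"
    by (rule locint_bound[OF lg, of _ "\<lambda>_. 1"]) auto
  \<comment> \<open>The derivative of \<open>|u|^2\<close>, written with \<open>prim g\<close> to
    match the product rule \<open>prim_mult\<close>.\<close>
  define d where "d t = g t * prim (\<lambda>t. cnj (g t)) t + prim g t * cnj (g t)" for t
  have ld: "locint d"
    unfolding d_def using prim_mult_affine(2)[OF lg lcg, of 0 0] by simp
  have dd: "prim g x * cnj (prim g x) = prim d x" for x
    unfolding prim_cnj[symmetric] d_def by (rule prim_mult[OF lg lcg])
  have d_eq: "f t * cnj (f t) - u t * cnj (u t) - d t = g t * cnj (g t)" if "0 < t" for t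
  proof -
    have "d t = g t * cnj (u t) + u t * cnj (g t)"
      using ug[of t] that by (simp add: d_def prim_cnj)
    then show ?thesis by (simp add: g_def algebra_simps)
  qed
  \<comment> \<open>By the energy identity \<open>r\<close> is \<open>|f - u|^2\<close>, so its
    primitive is nonnegative. The primitive of \<open>d\<close> is \<open>|u|^2\<close>, also
    nonnegative; hence the integral of \<open>|u|^2\<close> up to \<open>x\<close> never exceeds
    that of \<open>|f|^2\<close>.\<close>
  define r where "r t = f t * cnj (f t) + (- 1) * (u t * cnj (u t)) + (- 1) * d t" for t
  have lr: "locint r" unfolding r_def by (intro locint_add locint_cmult lff luu ld)
  have prim_r: "prim r x = prim (\<lambda>t. f t * cnj (f t)) x - prim (\<lambda>t. u t * cnj (u t)) x - prim d x" for x
    unfolding r_def prim_add[OF locint_add[OF lff locint_cmult[OF luu]] locint_cmult[OF ld]]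
      prim_add[OF lff locint_cmult[OF luu]] prim_cmult by simp
  have "u \<in> sqint"
  proof (rule sqint_of_bounded_prim[OF _ luu])
    fix x :: real assume x: "0 \<le> x"
    have "prim r x = prim (\<lambda>t. g t * cnj (g t)) x"
      by (rule prim_cong) (use d_eq in \<open>simp add: r_def\<close>)
    moreover have "locint (\<lambda>t. g t * cnj (g t))"
    proof -
      have "cutoff (\<lambda>t. g t * cnj (g t)) x t = cutoff r x t" if "t \<in> space Rp" for x t
        using d_eq[of t] that by (simp add: cutoff_def r_def)
      then have "integrable Rp (cutoff (\<lambda>t. g t * cnj (g t)) x)" for x
        using locintD[OF lr, of x] by (subst Bochner_Integration.integrable_cong[of _ Rp _ "cutoff r x"]) auto
      then show ?thesis unfolding locint_def by simp
    qed
    ultimately have "0 \<le> Re (prim r x)"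
      using Re_prim_nonneg[of "\<lambda>t. g t * cnj (g t)" x] by simp
    moreover have "0 \<le> Re (prim d x)"
      unfolding dd[symmetric] by simp
    moreover have "Re (prim (\<lambda>t. f t * cnj (f t)) x) \<le> (\<integral>t. cmod (f t * cnj (f t)) \<partial>Rp)"
    proof -
      let ?F = "\<lambda>t. f t * cnj (f t)"
      have "Re (prim ?F x) \<le> cmod (prim ?F x)" by (rule complex_Re_le_cmod)
      also have "\<dots> \<le> (\<integral>t. cmod (cutoff ?F x t) \<partial>Rp)" by (rule norm_prim_le[OF lff order_refl])
      also have "\<dots> \<le> (\<integral>t. cmod (?F t) \<partial>Rp)"
        by (intro integral_mono integrable_norm locintD lff sqint_mult_integrable sqint_cnj f) (simp add: cutoff_def)
      finally show ?thesis .
    qed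
    ultimately show "Re (prim (\<lambda>t. u t * cnj (u t)) x) \<le> (\<integral>t. cmod (f t * cnj (f t)) \<partial>Rp)"
      unfolding prim_r by simp
  qed measurable
  moreover from this have "g \<in> sqint"
    unfolding g_def[abs_def] using sqint_add[OF f sqint_cmult[of u "-1"]] by simp
  ultimately have "sob1 u 0 (\<lambda>x. f x - u x)"
    unfolding sob1_iff g_def[symmetric, abs_def] using ug by (auto intro!: AE_I2)
  then show ?thesis by blast
qed

section \<open>Exponential moments\<close>

text \<open>Substituting \<open>s = exp (-t)\<close> turns \<open>\<phi>\<close> into a continuous
  function on \<open>[0,1]\<close> and the moments into integrals against \<open>s ^ n\<close>; the
  extra 1 in the exponent is the density of \<open>ds\<close>. If a polynomial \<open>p\<close> in
  \<open>s\<close> approximates it within \<open>e\<close>, the weighted energy \<open>J\<close>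
  equals the integral of \<open>exp (-t) * \<phi> * (\<phi> - p)\<close>, which is at most
  \<open>e * C\<close>. So \<open>J\<close> is 0.\<close>

lemma exp_moments_zero_imp:
  fixes \<phi> :: "real \<Rightarrow> real"
  assumes cont: "continuous_on UNIV \<phi>" and lim: "(\<phi> \<longlongrightarrow> 0) at_top"
    and sq: "(\<lambda>t. complex_of_real (\<phi> t)) \<in> sqint"
    and mom: "\<And>n::nat. (\<integral>t. \<phi> t * exp (- (real n + 1) * t) \<partial>Rp) = 0"
  shows "AE t in Rp. \<phi> t = 0"
proof -
  have [measurable]: "\<phi> \<in> borel_measurable Rp"
    using cont by (rule measurable_Rp_borel[OF borel_measurable_continuous_onI])
  have [measurable]: "(\<lambda>t. exp (- t)) \<in> borel_measurable Rp"
    by (intro measurable_Rp_borel borel_measurable_continuous_onI continuous_intros)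
  have int: "integrable Rp (\<lambda>t. \<phi> t * exp (- (real n + 1) * t))" for n :: nat
  proof -
    have "integrable Rp (\<lambda>t. complex_of_real (\<phi> t) * complex_of_real (exp (- (real n + 1) * t)))"
      by (intro sqint_mult_integrable sq sqint_exp) simp
    from integrable_Re[OF this] show ?thesis by simp
  qed
  have int1: "integrable Rp (\<lambda>t. exp (- t) * \<bar>\<phi> t\<bar>)"
    using integrable_norm[OF int[of 0]] by (simp add: abs_mult mult.commute)
  have int2: "integrable Rp (\<lambda>t. exp (- t) * (\<phi> t)\<^sup>2)"
  proof (rule Bochner_Integration.integrable_bound)
    show "integrable Rp (\<lambda>t. (\<phi> t)\<^sup>2)" using sqint_integrable[OF sq] by simp
    show "AE t in Rp. norm (exp (- t) * (\<phi> t)\<^sup>2) \<le> norm ((\<phi> t)\<^sup>2)"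
      by (intro AE_I2) (simp add: mult_left_le_one_le)
  qed measurable
  define C where "C = (\<integral>t. exp (- t) * \<bar>\<phi> t\<bar> \<partial>Rp)"
  define J where "J = (\<integral>t. exp (- t) * (\<phi> t)\<^sup>2 \<partial>Rp)"
  \<comment> \<open>The value at \<open>s = 0\<close> is the limit of \<open>\<phi>\<close> at
    infinity; continuity at this endpoint is where the decay enters.\<close>
  define \<psi> where "\<psi> s = (if s = 0 then 0 else \<phi> (- ln s))" for s
  have cont\<psi>: "continuous_on {0..1} \<psi>"
  proof (rule continuous_on_eq_continuous_within[THEN iffD2], intro ballI)
    fix s :: real assume s: "s \<in> {0..1}"
    show "continuous (at s within {0..1}) \<psi>"
    proof (cases "s = 0")
      case True
      have "filterlim (\<lambda>x. - ln x) at_top (at_right (0::real))"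
        by (rule filterlim_compose[OF filterlim_uminus_at_top_at_bot ln_at_0])
      then have "((\<lambda>x. \<phi> (- ln x)) \<longlongrightarrow> 0) (at_right 0)"
        by (rule filterlim_compose[OF lim])
      then have "(\<psi> \<longlongrightarrow> 0) (at_right 0)"
        by (rule Lim_transform_eventually) (auto simp: \<psi>_def eventually_at_filter)
      moreover have "at (0::real) within {0..1} = at_right 0"
        by (simp add: at_within_Icc_at_right)
      ultimately show ?thesis
        using True by (simp add: continuous_within \<psi>_def)
    next
      case False
      then have "s > 0" using s by simp
      have "isCont \<phi> (- ln s)" using cont by (simp add: continuous_on_eq_continuous_at)
      then have "isCont (\<lambda>x. \<phi> (- ln x)) s"
        by (rule isCont_o2[rotated]) (use \<open>s > 0\<close> in \<open>auto intro!: isCont_minus isCont_ln\<close>)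
      moreover have "\<forall>\<^sub>F x in nhds s. x \<in> {0<..}"
        using \<open>s > 0\<close> by (intro eventually_nhds_in_open) auto
      then have "\<forall>\<^sub>F x in nhds s. \<psi> x = \<phi> (- ln x)"
        by eventually_elim (simp add: \<psi>_def)
      ultimately have "isCont \<psi> s" by (simp add: isCont_cong)
      then show ?thesis by (rule continuous_at_imp_continuous_at_within)
    qed
  qed
  have le: "J \<le> e * C" if e: "e > 0" for e
  proof -
    obtain p where p: "real_polynomial_function p" "\<And>x. x \<in> {0..1} \<Longrightarrow> \<bar>\<psi> x - p x\<bar> < e"
      using Stone_Weierstrass_real_polynomial_function[OF compact_Icc cont\<psi> e] by metis
    obtain a n where pa: "p = (\<lambda>x. \<Sum>i\<le>n::nat. a i * x ^ i)"
      using p(1) unfolding real_polynomial_function_iff_sum by blast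
    define P where "P t = exp (- t) * \<phi> t * p (exp (- t))" for t
    have P: "P t = (\<Sum>i\<le>n. a i * (\<phi> t * exp (- (real i + 1) * t)))" for t
      unfolding P_def pa sum_distrib_left
      by (rule sum.cong) (auto simp: exp_of_nat_mult[symmetric] algebra_simps exp_add exp_minus exp_diff divide_simps)
    have intP: "integrable Rp P"
      unfolding P by (intro Bochner_Integration.integrable_sum integrable_mult_right int)
    have P0: "(\<integral>t. P t \<partial>Rp) = 0"
    proof -
      have "(\<integral>t. P t \<partial>Rp) = (\<Sum>i\<le>n. \<integral>t. a i * (\<phi> t * exp (- (real i + 1) * t)) \<partial>Rp)"
        unfolding P by (intro Bochner_Integration.integral_sum integrable_mult_right int)
      also have "\<dots> = 0"
        by (intro sum.neutral ballI) (simp only: integral_mult_right_zero mom mult_zero_right)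
      finally show ?thesis .
    qed
    have "J = (\<integral>t. exp (- t) * (\<phi> t)\<^sup>2 - P t \<partial>Rp)"
      by (simp add: J_def P0 Bochner_Integration.integral_diff[OF int2 intP])
    also have "\<dots> \<le> (\<integral>t. e * (exp (- t) * \<bar>\<phi> t\<bar>) \<partial>Rp)"
    proof (intro integral_mono Bochner_Integration.integrable_diff int2 intP integrable_mult_right int1)
      fix t assume "t \<in> space Rp"
      then have t: "exp (- t) \<in> {0..1}" by simp
      have "\<psi> (exp (- t)) = \<phi> t" by (simp add: \<psi>_def)
      then have "\<bar>\<phi> t - p (exp (- t))\<bar> \<le> e" using p(2)[OF t] by simp
      then have "\<bar>\<phi> t\<bar> * \<bar>\<phi> t - p (exp (- t))\<bar> \<le> \<bar>\<phi> t\<bar> * e" by (intro mult_left_mono) auto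
      then have "\<phi> t * (\<phi> t - p (exp (- t))) \<le> \<bar>\<phi> t\<bar> * e"
        by (metis abs_le_D1 abs_mult)
      then have "exp (- t) * (\<phi> t * (\<phi> t - p (exp (- t)))) \<le> exp (- t) * (\<bar>\<phi> t\<bar> * e)"
        by (intro mult_left_mono) auto
      then show "exp (- t) * (\<phi> t)\<^sup>2 - P t \<le> e * (exp (- t) * \<bar>\<phi> t\<bar>)"
        by (simp add: P_def power2_eq_square algebra_simps)
    qed
    also have "\<dots> = e * C" by (simp add: C_def)
    finally show ?thesis .
  qed
  have "C \<ge> 0" unfolding C_def by (intro Bochner_Integration.integral_nonneg) simp
  have "J \<le> 0"
  proof (rule field_le_epsilon)
    fix e :: real assume e: "0 < e"
    \<comment> \<open>\<open>C + 1\<close> in place of \<open>C\<close> keeps the tolerance positive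
      when \<open>C = 0\<close>.\<close>
    have "J \<le> e / (C + 1) * C" using e \<open>C \<ge> 0\<close> by (intro le) simp
    also have "\<dots> \<le> e" using e \<open>C \<ge> 0\<close> by (simp add: field_simps)
    finally show "J \<le> 0 + e" by simp
  qed
  moreover have "0 \<le> J" unfolding J_def by (intro Bochner_Integration.integral_nonneg) simp
  ultimately have "J = 0" by simp
  then have "AE t in Rp. exp (- t) * (\<phi> t)\<^sup>2 = 0"
    unfolding J_def by (subst (asm) integral_nonneg_eq_0_iff_AE[OF int2]) auto
  then show ?thesis by eventually_elim simp
qed

text \<open>The continuous representative \<open>U\<close> tends to 0 at infinity. The exponentials
  are real, so the moments of its real and imaginary parts vanish separately, and real polynomial
  approximation applies to each.\<close>

lemma sob1_exp_moments_zero_imp: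
  assumes u: "sob1 u c du"
    and mom: "\<And>n::nat. (\<integral>t. u t * complex_of_real (exp (- (real n + 1) * t)) \<partial>Rp) = 0"
  shows "AE t in Rp. u t = 0"
proof -
  define U where "U x = c + prim du x" for x
  have us: "u \<in> sqint" and dus: "du \<in> sqint" and ae: "AE t in Rp. u t = U t"
    using u by (auto simp: sob1_iff U_def)
  have cont: "continuous_on UNIV U"
    unfolding U_def continuous_on_eq_continuous_at[OF open_UNIV]
    by (intro ballI continuous_intros continuous_prim sqint_locint dus)
  have [measurable]: "U \<in> borel_measurable Rp" by (rule measurable_of_continuous[OF cont])
  note [measurable] = sqint_measurable[OF us]
  have lim: "(U \<longlongrightarrow> 0) at_top"
    unfolding U_def[abs_def] by (rule sob1_tendsto_zero[OF u])
  have Us: "U \<in> sqint" by (rule sqint_cong_AE[OF us ae]) simp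
  have me: "(\<lambda>t. complex_of_real (exp (- (real n + 1) * t))) \<in> borel_measurable Rp" for n :: nat
    by (rule sqint_measurable[OF sqint_exp]) simp
  have mom': "(\<integral>t. U t * complex_of_real (exp (- (real n + 1) * t)) \<partial>Rp) = 0" for n :: nat
  proof -
    have "(\<integral>t. U t * complex_of_real (exp (- (real n + 1) * t)) \<partial>Rp)
      = (\<integral>t. u t * complex_of_real (exp (- (real n + 1) * t)) \<partial>Rp)"
      using ae me[of n] by (intro integral_cong_AE) auto
    then show ?thesis by (simp only: mom)
  qed
  have int: "integrable Rp (\<lambda>t. U t * complex_of_real (exp (- (real n + 1) * t)))" for n :: nat
    by (intro sqint_mult_integrable Us sqint_exp) simp
  have "AE t in Rp. Re (U t) = 0"
  proof (rule exp_moments_zero_imp)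
    show "continuous_on UNIV (\<lambda>t. Re (U t))" by (intro continuous_intros cont)
    show "((\<lambda>t. Re (U t)) \<longlongrightarrow> 0) at_top" using tendsto_Re[OF lim] by simp
    show "(\<lambda>t. complex_of_real (Re (U t))) \<in> sqint"
      by (rule sqint_bound[OF _ sqint_integrable[OF Us]]) (auto simp: cmod_def)
    show "(\<integral>t. Re (U t) * exp (- (real n + 1) * t) \<partial>Rp) = 0" for n
      using integral_Re[OF int[of n]] unfolding mom' by simp
  qed
  moreover have "AE t in Rp. Im (U t) = 0"
  proof (rule exp_moments_zero_imp)
    show "continuous_on UNIV (\<lambda>t. Im (U t))" by (intro continuous_intros cont)
    show "((\<lambda>t. Im (U t)) \<longlongrightarrow> 0) at_top" using tendsto_Im[OF lim] by simp
    show "(\<lambda>t. complex_of_real (Im (U t))) \<in> sqint"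
      by (rule sqint_bound[OF _ sqint_integrable[OF Us]]) (auto simp: cmod_def)
    show "(\<integral>t. Im (U t) * exp (- (real n + 1) * t) \<partial>Rp) = 0" for n
      using integral_Im[OF int[of n]] unfolding mom' by simp
  qed
  ultimately show ?thesis using ae by eventually_elim (simp add: complex_eq_iff)
qed

section \<open>The operator \<open>i d/dx\<close>\<close>

lemma sob1_add: 
  assumes "sob1 u c du" "sob1 w b dw"
  shows "sob1 (\<lambda>x. u x + w x) (c + b) (\<lambda>x. du x + dw x)"
proof -
  have l: "locint du" "locint dw" and
    ae: "AE x in Rp. u x = c + prim du x" "AE x in Rp. w x = b + prim dw x"
    using assms by (auto simp: sob1_iff intro: sqint_locint)
  have "AE x in Rp. u x + w x = c + b + prim (\<lambda>x. du x + dw x) x"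
    using ae by eventually_elim (simp add: prim_add[OF l])
  then show ?thesis using assms by (simp add: sob1_iff sqint_add)
qed

lemma sob1_cmult: 
  assumes "sob1 u c du"
  shows "sob1 (\<lambda>x. k * u x) (k * c) (\<lambda>x. k * du x)"
proof -
  have "AE x in Rp. u x = c + prim du x"
    using assms by (auto simp: sob1_iff)
  then have "AE x in Rp. k * u x = k * c + prim (\<lambda>x. k * du x) x"
    by eventually_elim (simp add: prim_cmult distrib_left)
  then show ?thesis using assms by (simp add: sob1_iff sqint_cmult)
qed

lemma sob1_cong_AE:
  assumes "sob1 u c du" "AE x in Rp. u x = u' x" "AE x in Rp. du x = du' x" "u' \<in> sqint" "du' \<in> sqint"
  shows "sob1 u' c du'"
proof -
  have "prim du x = prim du' x" for x
    using assms by (intro prim_cong_AE) (auto simp: sob1_iff sqint_measurable)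
  moreover have "AE x in Rp. u x = c + prim du x"
    using assms by (auto simp: sob1_iff)
  ultimately have "AE x in Rp. u' x = c + prim du' x"
    using assms(2) by auto
  then show ?thesis using assms by (simp add: sob1_iff)
qed

text \<open>The graph of the componentwise operator \<open>i d/dx\<close> with zero boundary value: \<open>v = i u'\<close> is stated
  as \<open>u' = - i v\<close>, which makes the derivative an explicit function of \<open>v\<close>.\<close>

definition Bgraph :: "vf \<Rightarrow> vf \<Rightarrow> bool" where
  "Bgraph u v \<longleftrightarrow> sob1 (\<lambda>x. fst (u x)) 0 (\<lambda>x. - \<i> * fst (v x)) \<and>
     sob1 (\<lambda>x. snd (u x)) 0 (\<lambda>x. - \<i> * snd (v x))"

lemma Bgraph_L2: "Bgraph u v \<Longrightarrow> u \<in> L2" "Bgraph u v \<Longrightarrow> v \<in> L2"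
proof -
  assume B: "Bgraph u v"
  then show "u \<in> L2" by (simp add: Bgraph_def sob1_iff L2_def)
  have "(\<lambda>x. \<i> * (- \<i> * fst (v x))) \<in> sqint" "(\<lambda>x. \<i> * (- \<i> * snd (v x))) \<in> sqint"
    using B unfolding Bgraph_def sob1_iff by (intro sqint_cmult[of _ \<i>]; blast)+
  then show "v \<in> L2" by (simp add: L2_def)
qed

lemma Bgraph_vzero: "Bgraph vzero vzero"
  by (simp add: Bgraph_def sob1_iff sqint_def prim_def cutoff_def)

lemma Bgraph_vadd: "Bgraph u v \<Longrightarrow> Bgraph u' v' \<Longrightarrow> Bgraph (vadd u u') (vadd v v')"
  using sob1_add[of _ 0 "\<lambda>x. - \<i> * fst (v x)" _ 0 "\<lambda>x. - \<i> * fst (v' x)"]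
    sob1_add[of _ 0 "\<lambda>x. - \<i> * snd (v x)" _ 0 "\<lambda>x. - \<i> * snd (v' x)"]
  by (simp add: Bgraph_def algebra_simps)

lemma Bgraph_vsc: "Bgraph u v \<Longrightarrow> Bgraph (vsc c u) (vsc c v)"
  using sob1_cmult[of _ 0 "\<lambda>x. - \<i> * fst (v x)" c] sob1_cmult[of _ 0 "\<lambda>x. - \<i> * snd (v x)" c]
  by (simp add: Bgraph_def mult.left_commute)

lemma Bgraph_vdiff: "Bgraph u v \<Longrightarrow> Bgraph u' v' \<Longrightarrow> Bgraph (vdiff u u') (vdiff v v')"
  unfolding vdiff_def by (intro Bgraph_vadd Bgraph_vsc)

lemma Bgraph_cong:
  assumes B: "Bgraph u v" and ae: "aeq u u'" "aeq v v'" and L: "u' \<in> L2" "v' \<in> L2"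
  shows "Bgraph u' v'"
proof -
  have "AE x in Rp. fst (u x) = fst (u' x)" "AE x in Rp. - \<i> * fst (v x) = - \<i> * fst (v' x)"
    "AE x in Rp. snd (u x) = snd (u' x)" "AE x in Rp. - \<i> * snd (v x) = - \<i> * snd (v' x)"
    using ae by (auto simp: aeq_def elim: eventually_mono)
  moreover note L[THEN L2_fst] L[THEN L2_snd] sqint_cmult[OF L2_fst[OF L(2)]] sqint_cmult[OF L2_snd[OF L(2)]]
  ultimately show ?thesis
    using B unfolding Bgraph_def by (blast intro: sob1_cong_AE)
qed

lemma sob1_symmetric:
  assumes "sob1 u 0 (\<lambda>x. - \<i> * v x)" "sob1 u' 0 (\<lambda>x. - \<i> * v' x)"
    and vq: "v \<in> sqint" "v' \<in> sqint"
  shows "(\<integral>x. v x * cnj (u' x) \<partial>Rp) = (\<integral>x. u x * cnj (v' x) \<partial>Rp)"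
proof -
  have uq: "u \<in> sqint" "u' \<in> sqint" using assms by (auto simp: sob1_iff)
  have int: "integrable Rp (\<lambda>x. v x * cnj (u' x))" "integrable Rp (\<lambda>x. u x * cnj (v' x))"
    by (intro sqint_mult_integrable sqint_cnj uq vq)+
  have "(\<integral>x. - \<i> * v x * cnj (u' x) + u x * cnj (- \<i> * v' x) \<partial>Rp) = 0"
    using sob1_integral_by_parts(1)[OF assms(1) sob1_cnj[OF assms(2)]] by simp
  also have "(\<lambda>x. - \<i> * v x * cnj (u' x) + u x * cnj (- \<i> * v' x))
     = (\<lambda>x. - \<i> * (v x * cnj (u' x) - u x * cnj (v' x)))"
    by (simp add: algebra_simps)
  finally have "(\<integral>x. v x * cnj (u' x) - u x * cnj (v' x) \<partial>Rp) = 0"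
    by simp
  then show ?thesis using Bochner_Integration.integral_diff[OF int] by simp
qed

lemma Bgraph_symmetric:
  assumes B: "Bgraph u v" and B': "Bgraph u' v'"
  shows "ip v u' = ip u v'"
proof -
  note L = Bgraph_L2[OF B] Bgraph_L2[OF B']
  have "(\<integral>x. fst (v x) * cnj (fst (u' x)) \<partial>Rp) = (\<integral>x. fst (u x) * cnj (fst (v' x)) \<partial>Rp)"
    "(\<integral>x. snd (v x) * cnj (snd (u' x)) \<partial>Rp) = (\<integral>x. snd (u x) * cnj (snd (v' x)) \<partial>Rp)"
    using B B' L unfolding Bgraph_def by (auto intro!: sob1_symmetric L2_fst L2_snd)
  then show ?thesis using L by (simp add: ip_split)
qed

lemma Bgraph_single_valued:
  assumes "Bgraph u v" "aeq u vzero" shows "aeq v vzero"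
proof -
  have "AE x in Rp. fst (u x) = 0" "AE x in Rp. snd (u x) = 0"
    using assms(2) by (auto simp: aeq_def vzero_def elim: eventually_mono)
  then have "AE x in Rp. - \<i> * fst (v x) = 0" "AE x in Rp. - \<i> * snd (v x) = 0"
    using assms(1) sob1_zero_imp unfolding Bgraph_def by blast+
  then show ?thesis unfolding aeq_def by eventually_elim (simp add: vzero_def prod_eq_iff)
qed

lemma Bgraph_resolvent:
  assumes f: "f \<in> L2"
  shows "\<exists>u v. Bgraph u v \<and> f = vadd v (vsc \<i> u)"
proof -
  \<comment> \<open>With \<open>u' = - \<i> v\<close>, the equation \<open>f = v + \<i> u\<close>
    reads \<open>u' + u = - \<i> f\<close>; hence the factor in front of \<open>f\<close>.\<close>
  obtain w1 where w1: "sob1 w1 0 (\<lambda>x. - \<i> * fst (f x) - w1 x)"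
    using resolvent_exists[OF sqint_cmult[OF L2_fst[OF f]]] by blast
  obtain w2 where w2: "sob1 w2 0 (\<lambda>x. - \<i> * snd (f x) - w2 x)"
    using resolvent_exists[OF sqint_cmult[OF L2_snd[OF f]]] by blast
  let ?u = "\<lambda>x. (w1 x, w2 x)"
  have "Bgraph ?u (vdiff f (vsc \<i> ?u))"
    using w1 w2 by (simp add: Bgraph_def algebra_simps)
  moreover have "f = vadd (vdiff f (vsc \<i> ?u)) (vsc \<i> ?u)"
    by (rule vf_eqI) auto
  ultimately show ?thesis by blast
qed

lemma Bgraph_Trel:
  assumes B: "Bgraph u v"
  shows "Trel (vadd v (vsc \<i> u)) (vdiff v (vsc \<i> u))"
proof -
  note L = Bgraph_L2[OF B]
  have v: "vsc \<i> (vsc (- \<i>) v) = v" by (rule vf_eqI) auto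
  have "sob1 (\<lambda>x. fst (u x)) 0 (\<lambda>x. fst (vsc (- \<i>) v x)) \<and>
        sob1 (\<lambda>x. snd (u x)) 0 (\<lambda>x. snd (vsc (- \<i>) v x)) \<and>
        aeq (vadd v (vsc \<i> u)) (vadd (vsc \<i> (vsc (- \<i>) v)) (vsc \<i> u)) \<and>
        aeq (vdiff v (vsc \<i> u)) (vdiff (vsc \<i> (vsc (- \<i>) v)) (vsc \<i> u))"
    using B unfolding v by (simp add: Bgraph_def)
  then show ?thesis
    unfolding Trel_def using L by (blast intro: L2_vadd L2_vdiff L2_vsc)
qed

text \<open>Without a boundary condition, \<open>i d/dx\<close> multiplies \<open>exp(-kx)\<close>
  by \<open>-ik\<close>, and \<open>u(0) = 0\<close> removes the boundary term. The eigenvalue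
  leaves the second argument of \<open>ip\<close> conjugated, as \<open>ik\<close>.\<close>

lemma ip_Bgraph_exp:
  assumes B: "Bgraph u v" and k: "0 < k"
    and e: "e = (\<lambda>x. (complex_of_real (exp (- k * x)), 0)) \<or> e = (\<lambda>x. (0, complex_of_real (exp (- k * x))))"
  shows "e \<in> L2" "ip v e = \<i> * k * ip u e"
proof -
  have L: "u \<in> L2" "v \<in> L2" using Bgraph_L2[OF B] by auto
  show eL: "e \<in> L2" using e sqint_exp[OF k] L2_vzero by (auto simp: L2_def)
  have key: "(\<integral>x. h x * complex_of_real (exp (- k * x)) \<partial>Rp) = \<i> * k * (\<integral>x. w x * complex_of_real (exp (- k * x)) \<partial>Rp)"
    if s: "sob1 w 0 (\<lambda>x. - \<i> * h x)" and hq: "h \<in> sqint" for w h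
  proof -
    let ?E = "\<lambda>x. complex_of_real (exp (- k * x))"
    have wq: "w \<in> sqint" using s by (auto simp: sob1_iff)
    have int: "integrable Rp (\<lambda>x. h x * ?E x)" "integrable Rp (\<lambda>x. w x * ?E x)"
      by (intro sqint_mult_integrable sqint_exp k hq wq)+
    have "(\<integral>x. - \<i> * h x * ?E x + w x * (- k * ?E x) \<partial>Rp) = 0"
      using sob1_integral_by_parts(1)[OF s sob1_exp[OF k]] by simp
    also have "(\<lambda>x. - \<i> * h x * ?E x + w x * (- k * ?E x)) = (\<lambda>x. - \<i> * (h x * ?E x) + - k * (w x * ?E x))"
      by (simp add: algebra_simps)
    also have "(\<integral>x. - \<i> * (h x * ?E x) + - k * (w x * ?E x) \<partial>Rp)
      = - \<i> * (\<integral>x. h x * ?E x \<partial>Rp) + - k * (\<integral>x. w x * ?E x \<partial>Rp)"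
      using int by (subst Bochner_Integration.integral_add) (auto simp del: mult_minus_left)
    finally have z: "- \<i> * (\<integral>x. h x * ?E x \<partial>Rp) + - k * (\<integral>x. w x * ?E x \<partial>Rp) = 0" .
    have "X - \<i> * k * Y = \<i> * (- \<i> * X + - k * Y)" for X Y :: complex
      by (simp add: algebra_simps)
    from this[of "\<integral>x. h x * ?E x \<partial>Rp" "\<integral>x. w x * ?E x \<partial>Rp"] show ?thesis
      unfolding z by simp
  qed
  have "sob1 (\<lambda>x. fst (u x)) 0 (\<lambda>x. - \<i> * fst (v x))" "sob1 (\<lambda>x. snd (u x)) 0 (\<lambda>x. - \<i> * snd (v x))"
    using B by (auto simp: Bgraph_def)
  note key[OF this(1) L2_fst[OF L(2)]] key[OF this(2) L2_snd[OF L(2)]]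
  then show "ip v e = \<i> * k * ip u e"
    using e by (auto simp: ip_def)
qed

section \<open>The part of \<open>i d/dx\<close> in a shift-invariant subspace\<close>

lemma closed_subspaceD:
  assumes "closed_subspace H"
  shows "f \<in> H \<Longrightarrow> f \<in> L2" "vzero \<in> H" "f \<in> H \<Longrightarrow> g \<in> H \<Longrightarrow> vadd f g \<in> H"
    "f \<in> H \<Longrightarrow> vsc c f \<in> H" "f \<in> H \<Longrightarrow> g \<in> H \<Longrightarrow> vdiff f g \<in> H"
    "f \<in> H \<Longrightarrow> g \<in> L2 \<Longrightarrow> aeq f g \<Longrightarrow> g \<in> H"
    "(\<And>n. s n \<in> H) \<Longrightarrow> f \<in> L2 \<Longrightarrow> (\<lambda>n. l2norm (vdiff (s n) f)) \<longlonglongrightarrow> 0 \<Longrightarrow> f \<in> H"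
  using assms unfolding closed_subspace_def vdiff_def by blast+

lemma closed_subspace_projection:
  assumes H: "closed_subspace H" and f: "f \<in> L2"
  obtains p where "p \<in> H" "\<And>x. x \<in> H \<Longrightarrow> ip x f = ip x p"
proof -
  note D = closed_subspaceD[OF H]
  have HL: "H \<subseteq> L2" using D(1) by blast
  obtain p s where p: "p \<in> L2" "\<And>n. s n \<in> H" "(\<lambda>n. l2norm (vdiff (s n) p)) \<longlonglongrightarrow> 0"
    and o: "\<And>v. v \<in> H \<Longrightarrow> ip (vdiff f p) v = 0"
    using L2_projection[OF HL D(2) D(3) D(4) f] by blast
  have "ip x f = ip x p" if x: "x \<in> H" for x
  proof -
    have "ip x (vdiff f p) = 0" by (subst ip_cnj) (simp add: o[OF x])
    then show ?thesis using D(1)[OF x] f p(1) by (simp add: ip_diff_right)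
  qed
  moreover have "p \<in> H" using D(7)[OF p(2,1,3)] .
  ultimately show thesis using that by blast
qed

text \<open>A symmetric operator has no nonzero eigenvector for a nonreal eigenvalue. Both
  maximality and simplicity reduce to this.\<close>

lemma ip_vsc_i_eq_imp_zero:
  assumes w: "w \<in> L2" and k: "k \<noteq> (0::real)" and eq: "ip (vsc (\<i> * k) w) w = ip w (vsc (\<i> * k) w)"
  shows "aeq w vzero"
proof -
  have "\<i> * k * ip w w = - \<i> * k * ip w w"
    using eq w by (simp add: ip_simps)
  then have "ip w w = 0" using k by (auto simp: complex_eq_iff)
  then show ?thesis using l2norm_eq_0_iff[OF w] by (simp add: ip_self)
qed

text \<open>The orbit enters the study of \<open>B\<close> only through these two properties of its
  orthogonal complement.\<close>

locale shift_invariant =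
  fixes M :: "vf set"
  assumes M_closed: "closed_subspace M"
    and T_inv: "f \<in> M \<Longrightarrow> Trel f g \<Longrightarrow> g \<in> M"
begin

lemmas M = closed_subspaceD[OF M_closed]

definition B :: "(vf \<times> vf) set" where
  "B = {(u, v). u \<in> M \<and> v \<in> M \<and> Bgraph u v}"

lemma B_resolvent:
  assumes f: "f \<in> M"
  obtains u v where "(u, v) \<in> B" "f = vadd v (vsc \<i> u)"
proof -
  obtain u v where uv: "Bgraph u v" "f = vadd v (vsc \<i> u)"
    using Bgraph_resolvent[OF M(1)[OF f]] by blast
  have g: "vdiff v (vsc \<i> u) \<in> M"
    using T_inv[OF f] Bgraph_Trel[OF uv(1)] uv(2) by simp
  have "v = vsc (1/2) (vadd f (vdiff v (vsc \<i> u)))"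
    unfolding uv(2) by (rule vf_eqI) auto
  moreover have "u = vsc (1 / (2 * \<i>)) (vdiff f (vdiff v (vsc \<i> u)))"
    unfolding uv(2) by (rule vf_eqI) auto
  ultimately have "v \<in> M" "u \<in> M"
    using f g M(3-5) by metis+
  with uv that show thesis unfolding B_def by blast
qed

text \<open>Project \<open>f\<close> onto the closure of the domain. The residual lies in
  \<open>M\<close>, hence is \<open>(B + i)u\<close> for some \<open>u\<close> in the domain, and it
  is orthogonal to that \<open>u\<close>: thus \<open>(Bu,u) + i(u,u) = 0\<close>. As
  \<open>(Bu,u)\<close> is real, \<open>u\<close> and with it the residual vanish.\<close>

lemma B_dense: "dense_domain M B"
  unfolding dense_domain_def
proof (intro ballI allI impI)
  fix f and e :: real assume f: "f \<in> M" and e: "0 < e"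
  define V where "V = fst ` B"
  have BI: "u \<in> V \<Longrightarrow> \<exists>v. (u, v) \<in> B" for u by (auto simp: V_def)
  have IB: "(u, v) \<in> B \<Longrightarrow> u \<in> V" for u v by (force simp: V_def)
  have VM: "V \<subseteq> M" by (auto simp: V_def B_def)
  have VL: "V \<subseteq> L2" using VM M(1) by blast
  have V0: "vzero \<in> V" by (rule IB[of _ vzero]) (simp add: B_def M(2) Bgraph_vzero)
  have Va: "vadd g h \<in> V" if gh: "g \<in> V" "h \<in> V" for g h
  proof -
    obtain v w where "(g, v) \<in> B" "(h, w) \<in> B" using BI[OF gh(1)] BI[OF gh(2)] by blast
    then have "(vadd g h, vadd v w) \<in> B" by (auto simp: B_def intro: Bgraph_vadd M(3))
    then show ?thesis by (rule IB)
  qed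
  have Vs: "vsc c g \<in> V" if g: "g \<in> V" for g c
  proof -
    obtain v where "(g, v) \<in> B" using BI[OF g] by blast
    then have "(vsc c g, vsc c v) \<in> B" by (auto simp: B_def intro: Bgraph_vsc M(4))
    then show ?thesis by (rule IB)
  qed
  obtain p s where p: "p \<in> L2" "\<And>n::nat. s n \<in> V" "(\<lambda>n. l2norm (vdiff (s n) p)) \<longlonglongrightarrow> 0"
    and o: "\<And>v. v \<in> V \<Longrightarrow> ip (vdiff f p) v = 0"
    using L2_projection[OF VL V0 Va Vs M(1)[OF f]] by blast
  have sM: "s n \<in> M" for n using p(2) VM by blast
  have pM: "p \<in> M" using M(7)[OF sM p(1,3)] .
  obtain u v where uv: "(u, v) \<in> B" "vdiff f p = vadd v (vsc \<i> u)"
    using B_resolvent[OF M(5)[OF f pM]] by blast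
  have Buv: "Bgraph u v" using uv(1) by (simp add: B_def)
  note L = Bgraph_L2[OF Buv]
  have "ip v u + \<i> * ip u u = 0"
    using o[OF IB[OF uv(1)]] L unfolding uv(2) by (simp add: ip_simps)
  moreover have "ip v u = cnj (ip v u)"
    using Bgraph_symmetric[OF Buv Buv] ip_cnj by metis
  then have "Im (ip v u) = 0" by (simp add: complex_eq_iff)
  ultimately have "l2norm u = 0"
    by (simp add: ip_self complex_eq_iff)
  then have "aeq u vzero" using l2norm_eq_0_iff[OF L(1)] by simp
  moreover from Bgraph_single_valued[OF Buv this] have "aeq v vzero" .
  ultimately have "aeq (vdiff f p) vzero"
    unfolding uv(2) aeq_def by eventually_elim (simp add: vzero_def vadd_def vsc_def)
  then have fp: "l2norm (vdiff f p) = 0"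
    using l2norm_eq_0_iff[OF L2_vdiff[OF M(1)[OF f] p(1)]] by simp
  obtain n where n: "l2norm (vdiff (s n) p) < e"
    using order_tendstoD(2)[OF p(3) e] by (auto simp: eventually_sequentially)
  have "l2norm (vdiff f (s n)) \<le> l2norm (vdiff f p) + l2norm (vdiff p (s n))"
    by (intro l2norm_vdiff_triangle M(1) f sM pM)
  then have "l2norm (vdiff f (s n)) < e"
    using n fp l2norm_vdiff_commute[OF p(1) M(1)[OF sM]] by simp
  then show "\<exists>(u, v)\<in>B. l2norm (vdiff f u) < e" using BI[OF p(2)] by blast
qed

lemma B_is_operator: "is_operator M B"
  unfolding is_operator_def
proof (intro conjI)
  show "B \<subseteq> M \<times> M" "(vzero, vzero) \<in> B" by (auto simp: B_def M(2) Bgraph_vzero)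
  show "\<forall>(u,v)\<in>B. \<forall>(u',v')\<in>B. (vadd u u', vadd v v') \<in> B"
    by (auto simp: B_def intro: M(3) Bgraph_vadd)
  show "\<forall>c. \<forall>(u,v)\<in>B. (vsc c u, vsc c v) \<in> B"
    by (auto simp: B_def intro: M(4) Bgraph_vsc)
  show "\<forall>(u,v)\<in>B. \<forall>u' v'. u' \<in> M \<and> v' \<in> M \<and> aeq u u' \<and> aeq v v' \<longrightarrow> (u',v') \<in> B"
    by (auto simp: B_def intro: Bgraph_cong M(1))
  show "\<forall>(u,v)\<in>B. \<forall>(u',v')\<in>B. aeq u u' \<longrightarrow> aeq v v'"
    using Bgraph_single_valued[OF Bgraph_vdiff] by (auto simp: B_def aeq_vdiff_iff)
qed

lemma B_symmetric: "symmetric_op M B"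
  unfolding symmetric_op_def using B_is_operator B_dense
  by (auto simp: B_def intro: Bgraph_symmetric)

text \<open>For \<open>(x,y)\<close> in a symmetric extension, surjectivity of \<open>B + i\<close>
  supplies \<open>u\<close> with \<open>Bu + iu = y + ix\<close>. The extension then maps
  \<open>x - u\<close> to \<open>-i(x - u)\<close>, so \<open>x - u\<close> vanishes almost
  everywhere, and \<open>(x,y)\<close> already belongs to \<open>B\<close>.\<close>

lemma B_maximal: "maximal_symmetric M B"
  unfolding maximal_symmetric_def
proof (intro conjI allI impI B_symmetric)
  fix G assume G: "symmetric_op M G \<and> B \<subseteq> G"
  then have op: "is_operator M G" and sym: "\<And>u v u' v'. (u,v) \<in> G \<Longrightarrow> (u',v') \<in> G \<Longrightarrow> ip v u' = ip u v'"
    and BG: "B \<subseteq> G"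
    by (auto simp: symmetric_op_def)
  have "(x, y) \<in> B" if xy: "(x, y) \<in> G" for x y
  proof -
    have xM: "x \<in> M" and yM: "y \<in> M" using op xy by (auto simp: is_operator_def)
    obtain u v where uv: "(u, v) \<in> B" "vadd y (vsc \<i> x) = vadd v (vsc \<i> u)"
      using B_resolvent[OF M(3)[OF yM M(4)[OF xM]]] by blast
    have uvM: "u \<in> M" "v \<in> M" using uv(1) by (auto simp: B_def)
    have "(vsc (-1) u, vsc (-1) v) \<in> G"
      using op subsetD[OF BG uv(1)] by (auto simp: is_operator_def)
    with op xy have d: "(vdiff x u, vdiff y v) \<in> G"
      by (auto simp: vdiff_def is_operator_def)
    have eq: "vdiff y v = vsc (\<i> * (- 1 :: real)) (vdiff x u)"
    proof (rule vf_eqI)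
      fix t
      have "vadd y (vsc \<i> x) t = vadd v (vsc \<i> u) t" using uv(2) by simp
      then show "fst (vdiff y v t) = fst (vsc (\<i> * (- 1 :: real)) (vdiff x u) t)"
        "snd (vdiff y v t) = snd (vsc (\<i> * (- 1 :: real)) (vdiff x u) t)"
        by (auto simp: prod_eq_iff algebra_simps)
    qed
    have wL: "vdiff x u \<in> L2" by (intro M(1) M(5) xM uvM)
    have "aeq (vdiff x u) vzero"
      using ip_vsc_i_eq_imp_zero[OF wL, of "-1"] sym[OF d d] unfolding eq by simp
    then have xu: "aeq u x" by (simp add: aeq_vdiff_iff aeq_sym)
    have "aeq (vdiff y v) (vsc (\<i> * (- 1 :: real)) vzero)"
      unfolding eq by (rule aeq_vsc) fact
    moreover have "vsc c vzero = vzero" for c by (rule vf_eqI) auto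
    ultimately have vy: "aeq v y" by (simp add: aeq_vdiff_iff aeq_sym)
    show ?thesis
      using Bgraph_cong[OF _ xu vy] uv(1) M(1) xM yM by (auto simp: B_def)
  qed
  then show "G = B" using BG by auto
qed

lemma selfadjoint_part_orthogonal_exp:
  assumes N: "closed_subspace N" and sa: "selfadjoint_op N (B \<inter> (N \<times> N))"
    and k: "0 < k" and x: "x \<in> N"
    and e: "e = (\<lambda>x. (complex_of_real (exp (- k * x)), 0)) \<or> e = (\<lambda>x. (0, complex_of_real (exp (- k * x))))"
  shows "ip x e = 0"
proof -
  note D = closed_subspaceD[OF N]
  have eL: "e \<in> L2" using ip_Bgraph_exp(1)[OF Bgraph_vzero k e] .
  obtain p where p: "p \<in> N" "\<And>x. x \<in> N \<Longrightarrow> ip x e = ip x p"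
    using closed_subspace_projection[OF N eL] by blast
  have pL: "p \<in> L2" using D(1) p(1) .
  define c where "c = \<i> * (- k)"
  \<comment> \<open>On \<open>N\<close>, pairing with \<open>p\<close> is pairing with
    \<open>e\<close>, so \<open>(v,p) = (u,-ikp)\<close> for all \<open>(u,v)\<close> in the part.
    Thus \<open>(p,-ikp)\<close> lies in the graph of the adjoint, which self-adjointness identifies
    with the part itself.\<close>
  have "(p, vsc c p) \<in> B \<inter> (N \<times> N)"
  proof -
    have "ip v p = ip u (vsc c p)" if uv: "(u, v) \<in> B \<inter> (N \<times> N)" for u v
    proof -
      have uvB: "Bgraph u v" and uvN: "u \<in> N" "v \<in> N" using uv by (auto simp: B_def)
      have "ip v p = \<i> * k * ip u p"
        using ip_Bgraph_exp(2)[OF uvB k e] p(2)[OF uvN(1)] p(2)[OF uvN(2)] by simp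
      also have "\<dots> = ip u (vsc c p)"
        using D(1)[OF uvN(1)] pL by (simp add: ip_sc_right c_def)
      finally show ?thesis .
    qed
    then show ?thesis
      using sa p(1) D(4)[OF p(1)] unfolding selfadjoint_op_def by blast
  qed
  then have "Bgraph p (vsc c p)" by (simp add: B_def)
  from Bgraph_symmetric[OF this this] have "aeq p vzero"
    using ip_vsc_i_eq_imp_zero[OF pL, of "- k"] k by (simp add: c_def)
  then have "ip x p = ip x vzero"
    using D(1)[OF x] pL L2_vzero by (intro ip_cong) auto
  then show ?thesis using p(2)[OF x] by simp
qed

lemma B_simple: "simple_op M B"
  unfolding simple_op_def
proof (intro conjI allI impI notI B_symmetric)
  fix N assume "reducing M B N \<and> (\<exists>u\<in>N. \<not> aeq u vzero)" and sa: "selfadjoint_op N (B \<inter> (N \<times> N))"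
  then obtain f where N: "closed_subspace N" and f: "f \<in> N" "\<not> aeq f vzero"
    by (auto simp: reducing_def)
  note D = closed_subspaceD[OF N]
  have zero: "aeq u vzero" if uv: "(u, v) \<in> B \<inter> (N \<times> N)" for u v
  proof -
    have uN: "u \<in> N" and Buv: "Bgraph u v" using uv by (auto simp: B_def)
    have s: "sob1 (\<lambda>x. fst (u x)) 0 (\<lambda>x. - \<i> * fst (v x))" "sob1 (\<lambda>x. snd (u x)) 0 (\<lambda>x. - \<i> * snd (v x))"
      using Buv by (auto simp: Bgraph_def)
    have "AE t in Rp. fst (u t) = 0"
    proof (rule sob1_exp_moments_zero_imp[OF s(1)])
      fix n :: nat
      show "(\<integral>t. fst (u t) * complex_of_real (exp (- (real n + 1) * t)) \<partial>Rp) = 0"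
        using selfadjoint_part_orthogonal_exp[OF N sa _ uN, of "real n + 1", OF _ disjI1[OF refl]]
        unfolding ip_def by simp
    qed
    moreover have "AE t in Rp. snd (u t) = 0"
    proof (rule sob1_exp_moments_zero_imp[OF s(2)])
      fix n :: nat
      show "(\<integral>t. snd (u t) * complex_of_real (exp (- (real n + 1) * t)) \<partial>Rp) = 0"
        using selfadjoint_part_orthogonal_exp[OF N sa _ uN, of "real n + 1", OF _ disjI2[OF refl]]
        unfolding ip_def by simp
    qed
    ultimately show ?thesis
      unfolding aeq_def by eventually_elim (simp add: vzero_def prod_eq_iff)
  qed
  \<comment> \<open>The domain of the part is dense in \<open>N\<close>, yet all its elements have
    just been found null, so the norm of \<open>f\<close> is arbitrarily small.\<close>
  have "l2norm f < e" if e: "e > 0" for e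
  proof -
    obtain u v where uv: "(u, v) \<in> B \<inter> (N \<times> N)" "l2norm (vdiff f u) < e"
      using sa f(1) e unfolding selfadjoint_op_def symmetric_op_def dense_domain_def by blast
    have uL: "u \<in> L2" and fL: "f \<in> L2" using uv(1) f(1) D(1) by auto
    have "vdiff f vzero = f" by (rule vf_eqI) auto
    then have "aeq (vdiff f u) f" using aeq_vdiff[OF aeq_refl zero[OF uv(1)], of f] by simp
    then show ?thesis using l2norm_cong[OF _ L2_vdiff[OF fL uL] fL] uv(2) by simp
  qed
  from this[of "l2norm f"] have "l2norm f = 0" by (metis l2norm_nonneg less_irrefl order_le_less)
  then show False using f l2norm_eq_0_iff[OF D(1)] by blast
qed

end

section \<open>The orthogonal complement of the orbit, and the boundary conditions on the domain of
  the square\<close>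

lemma orthogonal_complement_closed:
  assumes s: "\<And>n. s n \<in> L2"
  shows "closed_subspace {f \<in> L2. \<forall>n. ip f (s n) = 0}"
  unfolding closed_subspace_def
proof (intro conjI allI impI ballI)
  fix t f assume "(\<forall>n. t n \<in> {f \<in> L2. \<forall>n. ip f (s n) = 0}) \<and> f \<in> L2 \<and> (\<lambda>n. l2norm (vdiff (t n) f)) \<longlonglongrightarrow> 0"
  then have t: "\<And>n. t n \<in> L2" "\<And>n m. ip (t n) (s m) = 0" and f: "f \<in> L2"
    and lim: "(\<lambda>n. l2norm (vdiff (t n) f)) \<longlonglongrightarrow> 0" by auto
  have "ip f (s m) = 0" for m
  proof -
    have "cmod (ip f (s m)) \<le> l2norm (vdiff (t n) f) * l2norm (s m)" for n
      using ip_Cauchy_Schwarz[OF L2_vdiff[OF t(1) f] s] t f s by (simp add: ip_diff_left)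
    moreover have "(\<lambda>n. l2norm (vdiff (t n) f) * l2norm (s m)) \<longlonglongrightarrow> 0 * l2norm (s m)"
      by (intro tendsto_intros lim)
    ultimately have "cmod (ip f (s m)) \<le> 0 * l2norm (s m)"
      by (intro tendsto_lowerbound[of _ _ sequentially]) auto
    then show ?thesis by simp
  qed
  then show "f \<in> {f \<in> L2. \<forall>n. ip f (s n) = 0}" using f by simp
next
  fix f g assume f: "f \<in> {f \<in> L2. \<forall>n. ip f (s n) = 0}" and g: "g \<in> L2" "aeq f g"
  then have "ip f (s n) = ip g (s n)" for n using s by (intro ip_cong) auto
  then show "g \<in> {f \<in> L2. \<forall>n. ip f (s n) = 0}" using f g by auto
qed (auto simp: ip_simps s L2_vzero)

lemma lincomb_L2:
  assumes "\<And>n. s n \<in> L2" shows "lincomb s c n \<in> L2"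
proof (induction n)
  case 0
  have "lincomb s c 0 = vzero" by (rule vf_eqI) (auto simp: lincomb_def)
  then show ?case by (simp add: L2_vzero)
next
  case (Suc n)
  have "lincomb s c (Suc n) = vadd (lincomb s c n) (vsc (c n) (s n))"
    by (rule vf_eqI) (auto simp: lincomb_def)
  then show ?case using Suc assms by (simp add: L2_vadd L2_vsc)
qed

text \<open>Padding gives two combinations a common length, so that their coefficients can be
  added.\<close>

lemma lincomb_pad:
  assumes "n \<le> m" shows "lincomb s c n = lincomb s (\<lambda>k. if k < n then c k else 0) m"
proof -
  have "(\<Sum>k<n. c k * h k) = (\<Sum>k<m. (if k < n then c k else 0) * h k)" for h :: "nat \<Rightarrow> complex"
    using assms by (intro sum.mono_neutral_cong_left) auto
  then show ?thesis by (simp add: lincomb_def)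
qed

text \<open>Take \<open>f\<close> outside the closed span; the residual of its projection is
  orthogonal to every \<open>s n\<close>. It is not null: otherwise the combinations approximating
  the projection would approximate \<open>f\<close>.\<close>

lemma noncyclic_orthogonal_exists:
  assumes s: "\<And>n. s n \<in> L2" and ne: "cspan s \<noteq> L2"
  shows "\<exists>u\<in>{f \<in> L2. \<forall>n. ip f (s n) = 0}. \<not> aeq u vzero"
proof -
  obtain f where f: "f \<in> L2" "f \<notin> cspan s"
    using ne unfolding cspan_def by blast
  define V where "V = {lincomb s c n |c n. True}"
  have VL: "V \<subseteq> L2" using lincomb_L2[OF s] by (auto simp: V_def)
  have V0: "vzero \<in> V"
    unfolding V_def by (intro CollectI exI[of _ "\<lambda>_. 0"] exI[of _ 0] conjI vf_eqI) (auto simp: lincomb_def)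
  have Va: "vadd g h \<in> V" if gh: "g \<in> V" "h \<in> V" for g h
  proof -
    obtain c n d m where g: "g = lincomb s c n" and h: "h = lincomb s d m" using gh by (auto simp: V_def)
    define N where "N = max n m"
    obtain c' d' where g': "g = lincomb s c' N" and h': "h = lincomb s d' N"
      unfolding g h using lincomb_pad[of n N s c] lincomb_pad[of m N s d] by (auto simp: N_def)
    have "vadd g h = lincomb s (\<lambda>k. c' k + d' k) N"
      unfolding g' h' by (rule vf_eqI) (auto simp: lincomb_def sum.distrib distrib_right)
    then show ?thesis by (auto simp: V_def)
  qed
  have Vs: "vsc b g \<in> V" if g: "g \<in> V" for b g
  proof -
    obtain c n where g: "g = lincomb s c n" using g by (auto simp: V_def)
    have "vsc b g = lincomb s (\<lambda>k. b * c k) n"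
      unfolding g by (rule vf_eqI) (auto simp: lincomb_def sum_distrib_left mult.assoc)
    then show ?thesis by (auto simp: V_def)
  qed
  have sV: "s n \<in> V" for n
  proof -
    have "s n = lincomb s (\<lambda>k. if k = n then 1 else 0) (Suc n)"
      by (rule vf_eqI) (auto simp: lincomb_def)
    then show ?thesis unfolding V_def by blast
  qed
  obtain p t where p: "p \<in> L2" "\<And>n::nat. t n \<in> V" "(\<lambda>n. l2norm (vdiff (t n) p)) \<longlonglongrightarrow> 0"
    and o: "\<And>v. v \<in> V \<Longrightarrow> ip (vdiff f p) v = 0"
    using L2_projection[OF VL V0 Va Vs f(1)] by blast
  have "\<not> aeq (vdiff f p) vzero"
  proof
    assume "aeq (vdiff f p) vzero"
    then have fp: "l2norm (vdiff f p) = 0" using l2norm_eq_0_iff[OF L2_vdiff[OF f(1) p(1)]] by simp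
    have "\<exists>c n. l2norm (vdiff f (lincomb s c n)) < e" if e: "e > 0" for e
    proof -
      obtain n where n: "l2norm (vdiff (t n) p) < e"
        using order_tendstoD(2)[OF p(3) e] by (auto simp: eventually_sequentially)
      have tL: "t n \<in> L2" using p(2) VL by blast
      have "l2norm (vdiff f (t n)) \<le> l2norm (vdiff f p) + l2norm (vdiff p (t n))"
        by (intro l2norm_vdiff_triangle f p tL)
      then have "l2norm (vdiff f (t n)) < e"
        using n fp l2norm_vdiff_commute[OF p(1) tL] by simp
      moreover obtain c m where "t n = lincomb s c m" using p(2)[of n] by (auto simp: V_def)
      ultimately show ?thesis by metis
    qed
    then have "f \<in> cspan s" using f(1) by (simp add: cspan_def)
    then show False using f(2) by simp
  qed
  moreover have "vdiff f p \<in> {f \<in> L2. \<forall>n. ip f (s n) = 0}"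
    using o[OF sV] L2_vdiff[OF f(1) p(1)] by simp
  ultimately show ?thesis by blast
qed

lemma Hrel_of_Bgraph_sq:
  assumes uv: "Bgraph u v" and vw: "Bgraph v w" and orth: "ip u q = 0"
  shows "Hrel a q u w"
proof -
  note L = Bgraph_L2[OF uv] Bgraph_L2[OF vw]
  \<comment> \<open>From \<open>v = i u'\<close> and \<open>w = i v'\<close> follow
    \<open>u' = - i v\<close> and \<open>u'' = - w\<close>. With all boundary data 0, the terms
    carrying \<open>q\<close> and \<open>a\<close> drop out of \<open>Hrel\<close>.\<close>
  have "vsob2 u (0, 0) (vsc (- \<i>) v) (0, 0) (vsc (- 1) w)"
  proof -
    have "sob1 (\<lambda>x. - \<i> * fst (v x)) (- \<i> * 0) (\<lambda>x. - \<i> * (- \<i> * fst (w x)))"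
      "sob1 (\<lambda>x. - \<i> * snd (v x)) (- \<i> * 0) (\<lambda>x. - \<i> * (- \<i> * snd (w x)))"
      using vw unfolding Bgraph_def by (intro sob1_cmult[of _ 0]; blast)+
    then show ?thesis
      using uv by (simp add: vsob2_def Bgraph_def)
  qed
  moreover have "w = vadd (vsc (- 1) (vsc (- 1) w)) (vsc (br_r (0, 0)) q)"
    by (rule vf_eqI) (auto simp: br_r_def)
  then have "aeq w (vadd (vsc (- 1) (vsc (- 1) w)) (vsc (br_r (0, 0)) q))"
    by (metis aeq_refl)
  moreover have "br_s (0, 0) = 0" "br_r (0, 0) = a * br_r (0, 0) + ip u q"
    by (simp_all add: br_s_def br_r_def orth)
  ultimately show ?thesis
    unfolding Hrel_def using L by blast
qed

text \<open>Nontriviality of \<open>H0\<close> is claimed explicitly, since the zero operator in the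
  zero subspace would satisfy everything else.\<close>

theorem theorem3p3:
  fixes q :: vf
  assumes "q \<in> L2"
    and "noncyclic_Tadj q"
  shows "\<exists>H0 B. closed_subspace H0 \<and> (\<exists>u\<in>H0. \<not> aeq u vzero) \<and>
           simple_op H0 B \<and> maximal_symmetric H0 B \<and>
           (\<forall>a. \<forall>(u,w)\<in>op_sq B. Hrel a q u w)"
proof -
  obtain s where s0: "aeq (s 0) q" and sT: "\<And>n. Tadj (s n) (s (Suc n))" and ne: "cspan s \<noteq> L2"
    using assms(2) by (auto simp: noncyclic_Tadj_def Tadj_orbit_def)
  have sL: "s n \<in> L2" for n using sT by (simp add: Tadj_def)
  define H where "H = {f \<in> L2. \<forall>n. ip f (s n) = 0}"
  have H: "closed_subspace H" unfolding H_def by (rule orthogonal_complement_closed[OF sL])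
  interpret shift_invariant H
  proof
    show "closed_subspace H" by (rule H)
    fix f g assume f: "f \<in> H" and T: "Trel f g"
    \<comment> \<open>Moving the shift to the other side replaces \<open>s n\<close> by
      \<open>s (Suc n)\<close>, again a member of the orbit, so orthogonality is inherited.\<close>
    have "ip g (s n) = ip f (s (Suc n))" for n
      using sT[of n] T by (simp add: Tadj_def)
    then show "g \<in> H" using f T by (simp add: H_def Trel_def)
  qed
  have "Hrel a q u w" if uw: "(u, w) \<in> op_sq B" for a u w
  proof -
    obtain v where uv: "Bgraph u v" "Bgraph v w" "u \<in> H"
      using uw by (auto simp: op_sq_def B_def)
    \<comment> \<open>The orbit starts at \<open>q\<close> only up to a null set, which the inner
      product does not see.\<close>
    have "ip u q = ip u (s 0)"
      using uv(3) s0 assms(1) sL by (intro ip_cong) (auto simp: H_def aeq_sym)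
    then have "ip u q = 0" using uv(3) by (simp add: H_def)
    then show ?thesis by (rule Hrel_of_Bgraph_sq[OF uv(1,2)])
  qed
  moreover have "\<exists>u\<in>H. \<not> aeq u vzero"
    unfolding H_def by (rule noncyclic_orthogonal_exists[OF sL ne])
  ultimately show ?thesis
    using H B_simple B_maximal by blast
qed

end
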